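(* Let $\eta\in\Omega_{<\infty}$. For any $k\in\mathbb N$, $i\in\mathbb Z_{\ge0}$ and $\ell\in\mathbb N\cup\{\infty\}$, $$(T_\ell\tilde\zeta)_k(i)=\tilde\zeta_k(i-(k\wedge\ell)),$$ with the convention that $\tilde\zeta_k(i)=0$ for $i<0$.
   Context: $\mathbb N=\{1,2,\dots\}$, $\Omega=\{0,1\}^{\mathbb N}$, $\Omega_{<\infty}=\{\eta\in\Omega\ ;\ \sum_{x\in\mathbb N}\eta(x)<\infty\}$, $a\wedge b=\min\{a,b\}$. BBS($\ell$), the box-ball system with carrier capacity $\ell\in\mathbb N\cup\{\infty\}$: for $\eta\in\Omega$ let $W_\ell(0)=0$ and, for $x\in\mathbb N$, $$W_\ell(x)=W_\ell(x-1)+\min\{\eta(x),\ell-W_\ell(x-1)\}-\min\{1-\eta(x),W_\ell(x-1)\},$$ and let $T_\ell:\Omega\to\Omega$ be $T_\ell\eta(x)=\eta(x)+W_\ell(x-1)-W_\ell(x)$. For any quantity $f$ depending on $\eta$, $T_\ell f$ denotes the same quantity computed from $T_\ell\eta$; thus $(T_\ell\tilde\zeta)_k(i)$ is $\tilde\zeta_k(i)$ computed for the configuration $T_\ell\eta$. A site $x\in\mathbb N$ is a record of $\eta$ if $W_\infty(x-1)=W_\infty(x)=0$. Takahashi-Satsuma (TS) algorithm for $\eta\in\Omega_{<\infty}$: a run is a maximal string of consecutive equal letters; the configuration is regarded as preceded by infinitely many $0$'s to the left of site $1$ (so the leading run of $0$'s is infinite). While there are uncrossed $1$'s: considering only uncrossed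 letters, select the leftmost run whose length is at least the length, denoted $k$, of the run preceding it; the first $k$ letters of this run together with the last $k$ letters of the preceding run form a $k$-soliton; cross out these $2k$ letters. A $k$-soliton is thus a set $\gamma=\{z(\gamma)_1<\cdots<z(\gamma)_{2k}\}\subset\mathbb N$. Every site of $\mathbb N$ is either a record or a component of exactly one soliton. Slot configuration: $\nu:\mathbb N\to\mathbb Z_{\ge0}\cup\{\infty\}$ is $\nu(x)=l-1$ if $x=z(\gamma)_l$ or $x=z(\gamma)_{l+k}$ for some $k$-soliton $\gamma$ of $\eta$ and $1\le l\le k$, and $\nu(x)=\infty$ if $x$ is a record. Put $\tilde\xi_k(0)=0$, $\tilde\xi_k(x)=\sum_{y=1}^x\mathbf 1_{\{\nu(y)\ge k\}}$, $\tilde s_k(i)=\min\{x\in\mathbb Z_{\ge0}\ ;\ \tilde\xi_k(x)=i\}$. Slot decomposition: for $k\in\mathbb N$, $i\in\mathbb Z_{\ge0}$, $\tilde\zeta_k(i)$ is the number of $k$-solitons $\gamma$ of $\eta$ with $\gamma\subset[\tilde s_k(i),\tilde s_k(i+1)-1]$. *)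

theory Defs
  imports Complex_Main "HOL-Library.Extended_Nat"
begin

(* Sites are the positive naturals. Configurations are total functions on nat; the value at the
   non-site 0 is fixed to 0, so that Omega corresponds exactly to the maps from {1, 2, ...}
   to {0, 1}. *)

definition Omega :: "(nat \<Rightarrow> int) set" where
  "Omega = {\<eta>. \<eta> 0 = 0 \<and> (\<forall>x\<ge>1. \<eta> x \<in> {0, 1})}"

definition Omega_fin :: "(nat \<Rightarrow> int) set" where
  "Omega_fin = {\<eta> \<in> Omega. summable (\<lambda>x. real_of_int (\<eta> x))}"

(* min {a, l - w}, which is a when the capacity l is infinite *)
definition min_room :: "int \<Rightarrow> enat \<Rightarrow> int \<Rightarrow> int" where
  "min_room a l w = (case l of enat n \<Rightarrow> min a (int n - w) | \<infinity> \<Rightarrow> a)"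

fun carrier_load :: "enat \<Rightarrow> (nat \<Rightarrow> int) \<Rightarrow> nat \<Rightarrow> int" where
  "carrier_load l \<eta> 0 = 0"
| "carrier_load l \<eta> (Suc x) =
     carrier_load l \<eta> x + min_room (\<eta> (Suc x)) l (carrier_load l \<eta> x)
       - min (1 - \<eta> (Suc x)) (carrier_load l \<eta> x)"

(* At x = 0 truncated subtraction makes the right-hand side equal to \<eta> 0. *)
definition bbs :: "enat \<Rightarrow> (nat \<Rightarrow> int) \<Rightarrow> nat \<Rightarrow> int" where
  "bbs l \<eta> x = \<eta> x + carrier_load l \<eta> (x - 1) - carrier_load l \<eta> x"

definition is_record :: "(nat \<Rightarrow> int) \<Rightarrow> nat \<Rightarrow> bool" where
  "is_record \<eta> x \<longleftrightarrow> x \<ge> 1 \<and> carrier_load \<infinity> \<eta> (x - 1) = 0 \<and> carrier_load \<infinity> \<eta> x = 0"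

(* In the Takahashi-Satsuma algorithm below, U is the set of uncrossed sites. The element 0 of U
   stands for all the infinitely many 0's to the left of site 1: the run containing 0 is the
   leading run, and its length is infinite. 0 never belongs to a soliton: the leading run has no
   predecessor, and it does not precede the selected run, since the run
   preceding that one has finite length k. *)

definition uncrossed_string :: "(nat \<Rightarrow> int) \<Rightarrow> nat set \<Rightarrow> nat set \<Rightarrow> bool" where
  "uncrossed_string \<eta> U S \<longleftrightarrow> S \<noteq> {} \<and> S \<subseteq> U
     \<and> (\<forall>x\<in>S. \<forall>z\<in>S. \<forall>y\<in>U. x \<le> y \<and> y \<le> z \<longrightarrow> y \<in> S)
     \<and> (\<forall>x\<in>S. \<forall>y\<in>S. \<eta> x = \<eta> y)"

definition is_run :: "(nat \<Rightarrow> int) \<Rightarrow> nat set \<Rightarrow> nat set \<Rightarrow> bool" where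
  "is_run \<eta> U R \<longleftrightarrow> uncrossed_string \<eta> U R
     \<and> (\<forall>S. uncrossed_string \<eta> U S \<and> R \<subseteq> S \<longrightarrow> S = R)"

definition run_length :: "nat set \<Rightarrow> enat" where
  "run_length R = (if finite R \<and> 0 \<notin> R then enat (card R) else \<infinity>)"

definition preceding_run :: "(nat \<Rightarrow> int) \<Rightarrow> nat set \<Rightarrow> nat set \<Rightarrow> nat set \<Rightarrow> bool" where
  "preceding_run \<eta> U P R \<longleftrightarrow> is_run \<eta> U P \<and> is_run \<eta> U R
     \<and> (\<forall>x\<in>P. \<forall>y\<in>R. x < y)
     \<and> \<not> (\<exists>z\<in>U. (\<forall>x\<in>P. x < z) \<and> (\<forall>y\<in>R. z < y))"

definition selectable :: "(nat \<Rightarrow> int) \<Rightarrow> nat set \<Rightarrow> nat set \<Rightarrow> nat set \<Rightarrow> bool" where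
  "selectable \<eta> U P R \<longleftrightarrow> preceding_run \<eta> U P R \<and> run_length P \<le> run_length R"

definition selected :: "(nat \<Rightarrow> int) \<Rightarrow> nat set \<Rightarrow> nat set \<Rightarrow> nat set \<Rightarrow> bool" where
  "selected \<eta> U P R \<longleftrightarrow> selectable \<eta> U P R
     \<and> (\<forall>P' R'. selectable \<eta> U P' R' \<longrightarrow> R' = R \<or> (\<forall>x\<in>R. \<forall>y\<in>R'. x < y))"

definition first_letters :: "nat \<Rightarrow> nat set \<Rightarrow> nat set" where
  "first_letters k R = {x\<in>R. card {y\<in>R. y < x} < k}"

definition last_letters :: "nat \<Rightarrow> nat set \<Rightarrow> nat set" where
  "last_letters k R = {x\<in>R. card {y\<in>R. x < y} < k}"

definition ts_step :: "(nat \<Rightarrow> int) \<Rightarrow> nat set \<Rightarrow> nat \<Rightarrow> nat set \<Rightarrow> bool" where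
  "ts_step \<eta> U k \<gamma> \<longleftrightarrow> (\<exists>x\<in>U. \<eta> x = 1)
     \<and> (\<exists>P R. selected \<eta> U P R \<and> run_length P = enat k
            \<and> \<gamma> = first_letters k R \<union> last_letters k P)"

inductive ts_uncrossed :: "(nat \<Rightarrow> int) \<Rightarrow> nat set \<Rightarrow> bool" for \<eta> where
  init: "ts_uncrossed \<eta> UNIV"
| cross: "ts_uncrossed \<eta> U \<Longrightarrow> ts_step \<eta> U k \<gamma> \<Longrightarrow> ts_uncrossed \<eta> (U - \<gamma>)"

definition soliton :: "(nat \<Rightarrow> int) \<Rightarrow> nat \<Rightarrow> nat set \<Rightarrow> bool" where
  "soliton \<eta> k \<gamma> \<longleftrightarrow> (\<exists>U. ts_uncrossed \<eta> U \<and> ts_step \<eta> U k \<gamma>)"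

(* z(\<gamma>)_l, with l counted from 1 *)
definition component :: "nat set \<Rightarrow> nat \<Rightarrow> nat" where
  "component \<gamma> l = sorted_list_of_set \<gamma> ! (l - 1)"

(* The description is well defined at every site that is not a record, since such a site is a
   component of exactly one soliton. *)
definition slot_config :: "(nat \<Rightarrow> int) \<Rightarrow> nat \<Rightarrow> enat" where
  "slot_config \<eta> x =
     (if is_record \<eta> x then \<infinity>
      else enat (THE v. \<exists>k \<gamma> l. soliton \<eta> k \<gamma> \<and> 1 \<le> l \<and> l \<le> k
             \<and> (x = component \<gamma> l \<or> x = component \<gamma> (l + k)) \<and> v = l - 1))"

definition slot_count :: "(nat \<Rightarrow> int) \<Rightarrow> nat \<Rightarrow> nat \<Rightarrow> nat" where
  "slot_count \<eta> k x = (\<Sum>y=1..x. of_bool (slot_config \<eta> y \<ge> enat k))"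

definition slot_pos :: "(nat \<Rightarrow> int) \<Rightarrow> nat \<Rightarrow> nat \<Rightarrow> nat" where
  "slot_pos \<eta> k i = (LEAST x. slot_count \<eta> k x = i)"

definition slot_decomp :: "(nat \<Rightarrow> int) \<Rightarrow> nat \<Rightarrow> int \<Rightarrow> nat" where
  "slot_decomp \<eta> k i =
     (if i < 0 then 0
      else card {\<gamma>. soliton \<eta> k \<gamma>
                  \<and> \<gamma> \<subseteq> {slot_pos \<eta> k (nat i) ..< slot_pos \<eta> k (nat i + 1)}})"

end

theory Submission
  imports Defs "HOL-Library.Infinite_Set"
begin

text \<open>
  Deleting the first letter of every run of a configuration (except the leading run of zeros)
  removes the 1-solitons and the two outermost slots of every other soliton. Hence it turns
  \<open>(k + 1)\<close>-solitons into \<open>k\<close>-solitons, lowers every slot number by one, and the slot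
  decomposition at level \<open>k + 1\<close> is that of the shortened configuration at level \<open>k\<close>. A carrier
  of capacity \<open>l + 1\<close> acts on the shortened configuration as a carrier of capacity \<open>l\<close>, up to one
  additional site in front, which is a record. Induction on \<open>k\<close> therefore reduces the claim to the
  1-solitons, which pair up the letters in a maximal alternating stretch.

  That the Takahashi-Satsuma algorithm is compatible with this deletion follows from the fact that
  its first step only depends on a local pattern: a run of length \<open>k\<close> that is preceded by a longer
  run and followed by a run of length at least \<open>k\<close>.
\<close>

subsection \<open>Deleting the first letter of every run\<close>

text \<open>Why the shift is the minimum of \<open>k\<close> and \<open>l\<close>: each deletion
  uses up one unit of capacity, and the record it puts in front moves the slot decomposition by one.
  A \<open>k\<close>-soliton needs \<open>k - 1\<close> deletions to become a 1-soliton, and the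
  motion of the 1-solitons contributes the last unit. If the capacity runs out earlier, the
  remaining evolution is the identity and adds no further shift. The obstacle is that solitons are
  defined by an algorithm that treats one run at a time, whereas deletion acts on all runs at once.
  Solitons are therefore described a second time, by the recursion \<open>sol\<close>, and both
  descriptions are compared by cutting out what the first step of the algorithm crosses out. The
  algorithm survives the cut because it sees only the order of the uncrossed sites, the recursion
  because the cut preserves repeats and the parities inside alternating stretches.\<close>

definition finconf :: "(nat \<Rightarrow> int) \<Rightarrow> bool" where
  "finconf \<eta> \<longleftrightarrow> \<eta> 0 = 0 \<and> (\<forall>x. \<eta> x = 0 \<or> \<eta> x = 1) \<and> (\<exists>N. \<forall>x\<ge>N. \<eta> x = 0)"

text \<open>Site 0 is enumerated as well, since truncated subtraction gives
  \<open>0 - 1 = 0\<close>; hence \<open>stay \<eta> 0 = 0\<close>, and the letter standing for the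
  leading run is never deleted.\<close>

definition stay :: "(nat \<Rightarrow> int) \<Rightarrow> nat \<Rightarrow> nat" where
  "stay \<eta> = enumerate {x. \<eta> x = \<eta> (x - 1)}"

definition skip :: "(nat \<Rightarrow> int) \<Rightarrow> nat \<Rightarrow> int" where
  "skip \<eta> = \<eta> \<circ> stay \<eta>"

lemma finconf_0: "finconf \<eta> \<Longrightarrow> \<eta> 0 = 0"
  by (simp add: finconf_def)

lemma finconf_cases: "finconf \<eta> \<Longrightarrow> \<eta> x = 0 \<or> \<eta> x = 1"
  by (simp add: finconf_def)

lemma finconf_neq: "finconf \<eta> \<Longrightarrow> \<eta> x \<noteq> \<eta> y \<Longrightarrow> \<eta> z \<noteq> \<eta> y \<Longrightarrow> \<eta> x = \<eta> z"
  using finconf_cases by metis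

lemma finconf_comp:
  assumes "finconf \<eta>" "strict_mono f" "f 0 = 0"
  shows "finconf (\<eta> \<circ> f)"
proof -
  obtain N where "\<forall>x\<ge>N. \<eta> x = 0" using assms(1) by (auto simp: finconf_def)
  then have "\<forall>x\<ge>N. \<eta> (f x) = 0"
    using strict_mono_imp_increasing[OF assms(2)] by (meson order_trans)
  then show ?thesis using assms by (auto simp: finconf_def)
qed

lemma strict_mono_range_unique:
  fixes f g :: "nat \<Rightarrow> nat"
  assumes "strict_mono f" "strict_mono g" "range f = range g"
  shows "f = g"
proof
  fix n
  show "f n = g n"
  proof (induction n rule: less_induct)
    case (less n)
    obtain m where m: "g n = f m" using assms(3) by (metis rangeI imageE)
    obtain m' where m': "f n = g m'" using assms(3) by (metis rangeI imageE)
    have "n \<le> m"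
      using less m assms by (metis not_less strict_mono_eq nat_neq_iff)
    moreover have "n \<le> m'"
      using less m' assms by (metis not_less strict_mono_eq nat_neq_iff)
    ultimately show ?case
      using m m' assms by (metis order_antisym strict_mono_less_eq)
  qed
qed

lemma infinite_stay:
  assumes "finconf \<eta>"
  shows "infinite {x. \<eta> x = \<eta> (x - 1)}"
proof -
  obtain N where "\<forall>x\<ge>N. \<eta> x = 0" using assms by (auto simp: finconf_def)
  then have "{Suc N..} \<subseteq> {x. \<eta> x = \<eta> (x - 1)}" by (auto simp: Suc_le_eq)
  then show ?thesis using infinite_Ici infinite_super by blast
qed

lemma strict_mono_stay: "finconf \<eta> \<Longrightarrow> strict_mono (stay \<eta>)"
  unfolding stay_def by (intro strict_mono_enumerate infinite_stay)

lemma stay_less [simp]: "finconf \<eta> \<Longrightarrow> stay \<eta> i < stay \<eta> j \<longleftrightarrow> i < j"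
  and stay_le [simp]: "finconf \<eta> \<Longrightarrow> stay \<eta> i \<le> stay \<eta> j \<longleftrightarrow> i \<le> j"
  and stay_eq [simp]: "finconf \<eta> \<Longrightarrow> stay \<eta> i = stay \<eta> j \<longleftrightarrow> i = j"
  by (simp_all add: strict_mono_stay strict_mono_less strict_mono_less_eq strict_mono_eq)

lemma range_stay: "finconf \<eta> \<Longrightarrow> range (stay \<eta>) = {x. \<eta> x = \<eta> (x - 1)}"
  unfolding stay_def by (intro range_enumerate infinite_stay)

text \<open>The way in which \<open>stay\<close> of a modified configuration is computed later:
  guess an increasing map and check its range.\<close>

lemma stay_unique:
  assumes "finconf \<eta>" "strict_mono f" "range f = {x. \<eta> x = \<eta> (x - 1)}"
  shows "stay \<eta> = f"
  using assms by (simp add: range_stay strict_mono_range_unique strict_mono_stay)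

lemma stay_stays: "finconf \<eta> \<Longrightarrow> \<eta> (stay \<eta> i) = \<eta> (stay \<eta> i - 1)"
  using range_stay by blast

lemma stay_obtain:
  assumes "finconf \<eta>" "\<eta> x = \<eta> (x - 1)"
  obtains i where "x = stay \<eta> i"
  using assms range_stay[of \<eta>] by blast

lemma stay_0 [simp]: "finconf \<eta> \<Longrightarrow> stay \<eta> 0 = 0"
  by (metis stay_obtain stay_le le0 le_zero_eq diff_0_eq_0)

lemma stay_pos: "finconf \<eta> \<Longrightarrow> 0 < i \<Longrightarrow> 0 < stay \<eta> i"
  by (metis stay_0 stay_less)

lemma stay_ge: "finconf \<eta> \<Longrightarrow> i \<le> stay \<eta> i"
  by (simp add: strict_mono_imp_increasing strict_mono_stay)

lemma finconf_skip: "finconf \<eta> \<Longrightarrow> finconf (skip \<eta>)"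
  by (simp add: skip_def finconf_comp strict_mono_stay)

lemma skip_apply: "skip \<eta> i = \<eta> (stay \<eta> i)"
  by (simp add: skip_def)

lemma stay_between:
  assumes "finconf \<eta>" "stay \<eta> i < x" "x < stay \<eta> (Suc i)"
  shows "\<eta> x \<noteq> \<eta> (x - 1)"
proof
  assume "\<eta> x = \<eta> (x - 1)"
  then obtain j where "x = stay \<eta> j" using assms(1) stay_obtain by blast
  then show False using assms by simp
qed

lemma stay_interval:
  assumes "finconf \<eta>"
  obtains i where "stay \<eta> i \<le> x" "x < stay \<eta> (Suc i)"
proof -
  define i where "i = (GREATEST i. stay \<eta> i \<le> x)"
  have b: "\<forall>i. stay \<eta> i \<le> x \<longrightarrow> i \<le> x" using stay_ge[OF assms] order_trans by blast
  have "stay \<eta> 0 \<le> x" using assms by simp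
  then have 1: "stay \<eta> i \<le> x" unfolding i_def by (rule GreatestI_nat) (use b in blast)
  have "\<not> stay \<eta> (Suc i) \<le> x"
    using Greatest_le_nat[of "\<lambda>i. stay \<eta> i \<le> x" "Suc i" x] b unfolding i_def by fastforce
  then show ?thesis using 1 that by simp
qed

(* Whether the number of consecutive sites ending at x at which the letter changes is odd. *)
fun odd_jump :: "(nat \<Rightarrow> int) \<Rightarrow> nat \<Rightarrow> bool" where
  "odd_jump \<eta> 0 = False"
| "odd_jump \<eta> (Suc x) = (\<eta> (Suc x) \<noteq> \<eta> x \<and> \<not> odd_jump \<eta> x)"

lemma odd_jump_jump: "odd_jump \<eta> x \<Longrightarrow> \<eta> x \<noteq> \<eta> (x - 1)"
  by (cases x) auto

lemma odd_jump_stay: "finconf \<eta> \<Longrightarrow> \<not> odd_jump \<eta> (stay \<eta> i)"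
  using odd_jump_jump stay_stays by blast

text \<open>All sites strictly between consecutive kept sites are jumps, and with only two letters a
  jump determines the letter, so everything depends on the parity of the offset.\<close>

lemma gap_alternates:
  assumes "finconf \<eta>"
  shows "stay \<eta> i + t < stay \<eta> (Suc i) \<Longrightarrow>
    odd_jump \<eta> (stay \<eta> i + t) = odd t \<and> (\<eta> (stay \<eta> i + t) = \<eta> (stay \<eta> i)) = even t"
proof (induction t)
  case 0
  then show ?case using assms odd_jump_stay by simp
next
  case (Suc t)
  have "\<eta> (stay \<eta> i + Suc t) \<noteq> \<eta> (stay \<eta> i + t)"
    using stay_between[OF assms, of i "stay \<eta> i + Suc t"] Suc.prems by simp
  moreover have "odd_jump \<eta> (stay \<eta> i + t) = odd t" "(\<eta> (stay \<eta> i + t) = \<eta> (stay \<eta> i)) = even t"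
    using Suc by simp_all
  moreover have "\<eta> (stay \<eta> i + Suc t) = \<eta> (stay \<eta> i) \<longleftrightarrow> \<eta> (stay \<eta> i + t) \<noteq> \<eta> (stay \<eta> i)"
    using calculation(1) finconf_neq[OF assms] by metis
  ultimately show ?case by simp
qed

text \<open>The kept site \<open>stay \<eta> (Suc i)\<close> repeats the letter that ends the
  alternating stretch before it, so the parity of that stretch decides.\<close>

lemma skip_Suc_eq:
  assumes "finconf \<eta>"
  shows "skip \<eta> (Suc i) = skip \<eta> i \<longleftrightarrow> odd (stay \<eta> (Suc i) - stay \<eta> i)"
proof -
  define t where "t = stay \<eta> (Suc i) - stay \<eta> i - 1"
  have lt: "stay \<eta> i < stay \<eta> (Suc i)" using assms by simp
  have "\<eta> (stay \<eta> (Suc i)) = \<eta> (stay \<eta> i + t)"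
    using stay_stays[OF assms, of "Suc i"] lt by (simp add: t_def)
  moreover have "stay \<eta> i + t < stay \<eta> (Suc i)" using lt by (simp add: t_def)
  ultimately have "skip \<eta> (Suc i) = skip \<eta> i \<longleftrightarrow> even t"
    using gap_alternates[OF assms] by (simp add: skip_apply)
  then show ?thesis using lt by (simp add: t_def)
qed

text \<open>A kept site directly before \<open>stay \<eta> i\<close> could only be
  \<open>stay \<eta> (i - 1)\<close>, and the repeat at \<open>stay \<eta> i\<close> would then make
  both letters of \<open>skip \<eta>\<close> equal. Thus the site that a soliton gains in front of
  each half is a deleted one.\<close>

lemma stay_pred_jump:
  assumes "finconf \<eta>" "skip \<eta> i \<noteq> skip \<eta> (i - 1)"
  shows "\<eta> (stay \<eta> i - 1) \<noteq> \<eta> (stay \<eta> i - 1 - 1)"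
proof
  assume a: "\<eta> (stay \<eta> i - 1) = \<eta> (stay \<eta> i - 1 - 1)"
  then obtain j where j: "stay \<eta> i - 1 = stay \<eta> j" using assms(1) stay_obtain by blast
  have i: "0 < i" using assms(2) by (cases i) auto
  have "stay \<eta> (i - 1) < stay \<eta> i" "0 < stay \<eta> i" using assms i stay_pos by auto
  moreover then have "stay \<eta> j < stay \<eta> i" using j by simp
  ultimately have "j = i - 1"
    using j assms(1) by (metis Suc_diff_1 Suc_less_eq2 i le_less_Suc_eq le_simps(2) linorder_not_le stay_less stay_le Suc_pred)
  then show False using assms j stay_stays[OF assms(1), of i] by (simp add: skip_apply)
qed

text \<open>Termination measure: cutting out a block, or deleting the first letters of the runs of a
  nonzero configuration, loses a one.\<close>

definition ones :: "(nat \<Rightarrow> int) \<Rightarrow> nat" where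
  "ones \<eta> = card {x. \<eta> x \<noteq> 0}"

lemma finite_ones: "finconf \<eta> \<Longrightarrow> finite {x. \<eta> x \<noteq> 0}"
  unfolding finconf_def by (metis (mono_tags, lifting) finite_nat_set_iff_bounded mem_Collect_eq not_less)

lemma ones_comp:
  assumes "finconf \<eta>" "strict_mono f" "\<eta> x \<noteq> 0" "x \<notin> range f"
  shows "ones (\<eta> \<circ> f) < ones \<eta>"
proof -
  have "f ` {y. \<eta> (f y) \<noteq> 0} \<subset> {x. \<eta> x \<noteq> 0}" using assms by auto
  then have "card (f ` {y. \<eta> (f y) \<noteq> 0}) < card {x. \<eta> x \<noteq> 0}"
    using finite_ones[OF assms(1)] psubset_card_mono by blast
  then show ?thesis
    using assms(2) by (simp add: ones_def card_image strict_mono_imp_inj_on)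
qed

lemma first_one:
  assumes "finconf \<eta>" "\<eta> x \<noteq> 0"
  obtains y where "\<eta> y = 1" "0 < y" "\<eta> (y - 1) = 0" "y \<le> x"
proof -
  define y where "y = (LEAST y. \<eta> y \<noteq> 0)"
  have 1: "\<eta> y \<noteq> 0" unfolding y_def using assms(2) by (rule LeastI)
  have 2: "y > 0" using 1 assms(1) finconf_0 by (metis gr0I)
  have "\<eta> (y - 1) = 0" using not_less_Least[of "y - 1" "\<lambda>y. \<eta> y \<noteq> 0"] 2 unfolding y_def by auto
  moreover have "y \<le> x" unfolding y_def using assms(2) by (rule Least_le)
  moreover have "\<eta> y = 1" using 1 assms(1) finconf_cases by blast
  ultimately show ?thesis using 2 that by blast
qed

lemma ones_skip:
  assumes "finconf \<eta>" "\<eta> x \<noteq> 0"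
  shows "ones (skip \<eta>) < ones \<eta>"
proof -
  obtain y where "\<eta> y = 1" "0 < y" "\<eta> (y - 1) = 0" using assms first_one by metis
  moreover then have "y \<notin> range (stay \<eta>)" using range_stay[OF assms(1)] by simp
  ultimately show ?thesis
    unfolding skip_def using ones_comp[OF assms(1) strict_mono_stay[OF assms(1)], of y] by simp
qed

subsection \<open>Solitons by recursion on their size\<close>

(* The pair of lists is (z_1, ..., z_k), (z_(k+1), ..., z_(2k)). The 1-solitons of a maximal
   alternating stretch are its first two letters, the next two letters, and so on. A soliton of
   skip \<eta> gains the site directly before the first site of either half. *)
inductive sol :: "(nat \<Rightarrow> int) \<Rightarrow> nat list \<Rightarrow> nat list \<Rightarrow> bool" where
  unit: "odd_jump \<eta> x \<Longrightarrow> \<eta> (Suc x) \<noteq> \<eta> x \<Longrightarrow> sol \<eta> [x] [Suc x]"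
| lift: "sol (skip \<eta>) as bs \<Longrightarrow>
    sol \<eta> ((stay \<eta> (hd as) - 1) # map (stay \<eta>) as) ((stay \<eta> (hd bs) - 1) # map (stay \<eta>) bs)"

text \<open>The jumps at the two heads carry the induction: they are what
  \<open>stay_pred_jump\<close> needs to show that the inserted sites are new and again
  jumps.\<close>

lemma sol_invariant:
  assumes "sol \<eta> as bs" "finconf \<eta>"
  shows "as \<noteq> [] \<and> length bs = length as \<and> sorted_wrt (<) (as @ bs) \<and> 0 < hd as \<and>
    \<eta> (hd as) \<noteq> \<eta> (hd as - 1) \<and> \<eta> (hd bs) \<noteq> \<eta> (hd bs - 1)"
  using assms
proof (induction rule: sol.induct)
  case (unit \<eta> x)
  then show ?case by (cases x) (auto simp: odd_jump_jump)
next
  case (lift \<eta> as bs)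
  note f = \<open>finconf \<eta>\<close>
  have IH: "as \<noteq> []" "length bs = length as" "sorted_wrt (<) (as @ bs)" "0 < hd as"
    "skip \<eta> (hd as) \<noteq> skip \<eta> (hd as - 1)" "skip \<eta> (hd bs) \<noteq> skip \<eta> (hd bs - 1)"
    using lift.IH finconf_skip[OF f] by auto
  have bs: "bs \<noteq> []" using IH by auto
  have a: "\<eta> (stay \<eta> (hd as) - 1) \<noteq> \<eta> (stay \<eta> (hd as) - 1 - 1)"
    and b: "\<eta> (stay \<eta> (hd bs) - 1) \<noteq> \<eta> (stay \<eta> (hd bs) - 1 - 1)"
    using stay_pred_jump[OF f] IH by blast+
  have lt: "x < y" if "x \<in> set as" "y \<in> set bs" for x y
    using IH(3) that by (auto simp: sorted_wrt_append)
  have sa: "sorted_wrt (<) as" and sb: "sorted_wrt (<) bs"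
    using IH(3) by (auto simp: sorted_wrt_append)
  have ha: "hd as \<le> x" if "x \<in> set as" for x
    using sa that IH(1) by (cases as) (auto intro: less_imp_le)
  have hb: "hd bs \<le> x" if "x \<in> set bs" for x
    using sb that bs by (cases bs) (auto intro: less_imp_le)
  have pos: "0 < stay \<eta> (hd as)" using IH(4) stay_pos f by blast
  have ab: "hd as < hd bs" using lt IH(1) bs by simp
  then have pos': "0 < stay \<eta> (hd bs)" using stay_pos f by simp
  have less: "stay \<eta> x < stay \<eta> (hd bs) - 1" if "x \<in> set as" for x
  proof -
    have "stay \<eta> x < stay \<eta> (hd bs)" using lt[OF that] bs f by simp
    \<comment> \<open>The inserted site is a jump, whereas \<open>stay \<eta> x\<close> is a
      repeat.\<close>
    moreover have "stay \<eta> x \<noteq> stay \<eta> (hd bs) - 1"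
      using b stay_stays[OF f, of x] by auto
    ultimately show ?thesis by simp
  qed
  have less': "stay \<eta> (hd bs) - 1 < stay \<eta> x" if "x \<in> set bs" for x
    using hb[OF that] pos' f by (metis diff_less less_le_trans less_numeral_extra(1) stay_le)
  have less'': "stay \<eta> (hd as) - 1 < stay \<eta> x" if "x \<in> set as" for x
    using ha[OF that] pos f by (metis diff_less less_le_trans less_numeral_extra(1) stay_le)
  have less3: "stay \<eta> (hd as) - 1 < stay \<eta> x" if "x \<in> set bs" for x
    using lt[of "hd as" x] that IH(1) f less_imp_diff_less by auto
  have less4: "stay \<eta> (hd as) - 1 < stay \<eta> (hd bs) - 1"
    using less[of "hd as"] IH(1) by auto
  have s: "sorted_wrt (<) (map (stay \<eta>) as)" "sorted_wrt (<) (map (stay \<eta>) bs)"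
    using sa sb f by (simp_all add: sorted_wrt_map)
  have z: "0 < stay \<eta> (hd as) - 1" using a by (cases "stay \<eta> (hd as) - 1") auto
  have lt': "stay \<eta> x < stay \<eta> y" if "x \<in> set as" "y \<in> set bs" for x y
    using lt that f by simp
  show ?case
    using IH(1,2) a b z s less less' less'' less3 less4 lt'
    by (auto simp: sorted_wrt_append simp del: One_nat_def stay_less)
qed

lemma stay_Suc_eqI:
  assumes "finconf \<eta>" "stay \<eta> i < x" "\<eta> x = \<eta> (x - 1)"
    "\<And>y. stay \<eta> i < y \<Longrightarrow> y < x \<Longrightarrow> \<eta> y \<noteq> \<eta> (y - 1)"
  shows "stay \<eta> (Suc i) = x"
proof -
  obtain j where j: "x = stay \<eta> j" using assms(1,3) stay_obtain by blast
  then have "i < j" using assms by simp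
  moreover have "\<not> Suc i < j"
    using assms(4)[of "stay \<eta> (Suc i)"] stay_stays[OF assms(1), of "Suc i"] assms(1) j by auto
  ultimately have "j = Suc i" by linarith
  then show ?thesis using j by simp
qed

section \<open>Cutting a block out of a configuration\<close>

text \<open>Crossing out is modelled by relabelling: \<open>\<eta> \<circ> bypass p n\<close> is
  \<open>\<eta>\<close> without the \<open>n\<close> sites from \<open>p\<close> on, again a
  configuration on all sites, so that recursion applies to it.\<close>

definition bypass :: "nat \<Rightarrow> nat \<Rightarrow> nat \<Rightarrow> nat" where
  "bypass p n y = (if y < p then y else y + n)"

lemma strict_mono_bypass: "strict_mono (bypass p n)"
  by (auto simp: bypass_def strict_mono_def)

lemma range_bypass: "range (bypass p n) = {x. x < p \<or> p + n \<le> x}"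
proof -
  have "x \<in> range (bypass p n)" if "p + n \<le> x" for x
    using that by (intro range_eqI[of _ _ "x - n"]) (auto simp: bypass_def)
  moreover have "x \<in> range (bypass p n)" if "x < p" for x
    using that by (intro range_eqI[of _ _ x]) (auto simp: bypass_def)
  ultimately show ?thesis by (auto simp: bypass_def)
qed

lemma bypass_0: "0 < p \<Longrightarrow> bypass p n 0 = 0"
  by (simp add: bypass_def)

(* The local pattern that the first step of the Takahashi-Satsuma algorithm crosses out, namely
   [p, p + 2k). The run before it is longer than k; if that is the leading run, the truncated
   subtraction p - Suc k may be 0. *)
definition block :: "(nat \<Rightarrow> int) \<Rightarrow> nat \<Rightarrow> nat \<Rightarrow> bool" where
  "block \<eta> p k \<longleftrightarrow> 0 < p \<and> 0 < k \<and>
     (\<forall>y. p - Suc k \<le> y \<and> y < p \<longrightarrow> \<eta> y = \<eta> (p - 1)) \<and>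
     (\<forall>y. p \<le> y \<and> y < p + k \<longrightarrow> \<eta> y \<noteq> \<eta> (p - 1)) \<and>
     (\<forall>y. p + k \<le> y \<and> y < p + 2 * k \<longrightarrow> \<eta> y = \<eta> (p - 1))"

context
  fixes \<eta> :: "nat \<Rightarrow> int" and p k :: nat
  assumes f: "finconf \<eta>" and block: "block \<eta> p k"
begin

lemma block_pos: "0 < p" "0 < k"
  using block by (auto simp: block_def)

lemma block_before: "p - Suc k \<le> y \<Longrightarrow> y < p \<Longrightarrow> \<eta> y = \<eta> (p - 1)"
  and block_first: "p \<le> y \<Longrightarrow> y < p + k \<Longrightarrow> \<eta> y \<noteq> \<eta> (p - 1)"
  and block_second: "p + k \<le> y \<Longrightarrow> y < p + 2 * k \<Longrightarrow> \<eta> y = \<eta> (p - 1)"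
  using block unfolding block_def by blast+

lemma block_stay_before: "p - k \<le> y \<Longrightarrow> y < p \<Longrightarrow> \<eta> y = \<eta> (y - 1)"
  using block_before[of y] block_before[of "y - 1"] by (simp add: less_imp_diff_less)

lemma block_jump: "p \<le> y \<Longrightarrow> y < p + 2 * k \<Longrightarrow> \<eta> y \<noteq> \<eta> (y - 1) \<longleftrightarrow> y = p \<or> y = p + k"
proof -
  assume y: "p \<le> y" "y < p + 2 * k"
  consider "y = p" | "p < y" "y < p + k" | "y = p + k" | "p + k < y" using y by linarith
  then show ?thesis
  proof cases
    case 1
    then show ?thesis using block_first[of p] block_pos by simp
  next
    case 2
    then show ?thesis
      using block_first[of y] block_first[of "y - 1"] finconf_neq[OF f, of y "p - 1" "y - 1"] by simp
  next
    case 3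
    then show ?thesis using block_second[of y] block_first[of "y - 1"] block_pos by force
  next
    case 4
    then show ?thesis using block_second[of y] block_second[of "y - 1"] y by simp
  qed
qed

lemma block_not_odd: "\<not> odd_jump \<eta> (p - 1)"
proof -
  have "\<eta> (p - 1) = \<eta> (p - 1 - 1)" using block_pos by (intro block_stay_before) auto
  then show ?thesis using odd_jump_jump by blast
qed

lemma block_odd: "odd_jump \<eta> p"
  using block_not_odd block_first[of p] block_pos by (cases p) auto

abbreviation (input) "c \<equiv> bypass p (2 * k)"

lemma finconf_bypass: "finconf (\<eta> \<circ> c)"
  using f finconf_comp strict_mono_bypass bypass_0 block_pos by blast

text \<open>Only \<open>p\<close> is critical: its new left neighbour \<open>p - 1\<close> carries
  the same letter as the last site of the block. Hence jumps and repeats are unaffected by the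
  cut.\<close>

lemma bypass_pred: "(\<eta> \<circ> c) (y - 1) = \<eta> (c y - 1)"
proof (cases "y = p")
  case True
  then show ?thesis using block_second[of "p + 2 * k - 1"] block_pos by (auto simp: bypass_def)
qed (auto simp: bypass_def)

text \<open>Parity is at risk only across the cut, but neither \<open>p - 1\<close> nor the last
  site of the block is an odd jump. For \<open>k = 1\<close> the latter follows the odd jump
  \<open>p\<close>; otherwise it is a repeat.\<close>

lemma bypass_odd_jump: "odd_jump (\<eta> \<circ> c) y = odd_jump \<eta> (c y)"
proof (induction y)
  case 0
  then show ?case using bypass_0 block_pos by simp
next
  case (Suc y)
  consider "Suc y < p" | "Suc y = p" | "p \<le> y" by linarith
  then show ?case
  proof cases
    case 2
    note block_not_odd
    moreover have "\<not> odd_jump \<eta> (p + 2 * k - 1)"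
    proof (cases "k = 1")
      case True
      show ?thesis using True block_odd by simp
    next
      case False
      then have "\<eta> (p + 2 * k - 1) = \<eta> (p + 2 * k - 1 - 1)"
        using block_jump[of "p + 2 * k - 1"] block_pos by linarith
      then show ?thesis using odd_jump_jump by blast
    qed
    moreover have "y = p - 1" "y + 2 * k = p + 2 * k - 1" using 2 by auto
    ultimately have "\<not> odd_jump \<eta> y" "\<not> odd_jump \<eta> (y + 2 * k)" by simp_all
    moreover have c: "c y = y" "c (Suc y) = Suc (y + 2 * k)" using 2 by (auto simp: bypass_def)
    moreover have "\<eta> y = \<eta> (y + 2 * k)" using bypass_pred[of "Suc y"] c by simp
    ultimately show ?thesis using Suc by simp
  next
    case 1
    then show ?thesis using Suc by (simp add: bypass_def)
  next
    case 3
    then show ?thesis using Suc by (simp add: bypass_def)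
  qed
qed

lemma bypass_stay_image: "c ` {y. (\<eta> \<circ> c) y = (\<eta> \<circ> c) (y - 1)} = {x. \<eta> x = \<eta> (x - 1) \<and> x \<in> range c}"
  using bypass_pred by (auto simp del: o_apply) (auto simp: image_iff)

text \<open>Taking the left neighbour fails to commute with the cut only at \<open>p\<close>. A head
  at \<open>p\<close> would force a jump at \<open>p - 1\<close>, which lies in a run of more than
  \<open>k\<close> letters and is a repeat.\<close>

lemma bypass_head:
  assumes "skip (\<eta> \<circ> c) h \<noteq> skip (\<eta> \<circ> c) (h - 1)"
  shows "c (stay (\<eta> \<circ> c) h - 1) = c (stay (\<eta> \<circ> c) h) - 1"
proof -
  have "stay (\<eta> \<circ> c) h \<noteq> p"
  proof
    assume a: "stay (\<eta> \<circ> c) h = p"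
    have "(\<eta> \<circ> c) (p - 1) \<noteq> (\<eta> \<circ> c) (p - 1 - 1)"
      using stay_pred_jump[OF finconf_bypass assms] a by simp
    moreover have "\<eta> (p - 1) = \<eta> (p - 1 - 1)" using block_stay_before[of "p - 1"] block_pos by simp
    ultimately show False using block_pos by (simp add: bypass_def split: if_splits)
  qed
  then show ?thesis by (auto simp: bypass_def)
qed

text \<open>Both sites of a block of size 1 are jumps, so \<open>skip\<close> deletes the block
  anyway.\<close>

lemma block_1_stay:
  assumes "k = 1"
  shows "stay \<eta> = c \<circ> stay (\<eta> \<circ> c)"
proof (rule stay_unique[OF f])
  show "strict_mono (c \<circ> stay (\<eta> \<circ> c))"
    by (intro strict_mono_o strict_mono_bypass strict_mono_stay finconf_bypass)
  have "x \<in> range c" if "\<eta> x = \<eta> (x - 1)" for x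
    using block_jump[of x] that assms unfolding range_bypass by force
  then show "range (c \<circ> stay (\<eta> \<circ> c)) = {x. \<eta> x = \<eta> (x - 1)}"
    using bypass_stay_image range_stay[OF finconf_bypass] by (auto simp add: image_comp[symmetric] simp del: o_apply)
qed

text \<open>Both halves lose exactly their first site, and the longer run before them keeps at least
  \<open>k\<close> of the sites in view, one more than the new size \<open>k'\<close>. So deletion
  turns the block into a smaller one, and cutting commutes with deletion.\<close>

lemma block_skip:
  assumes "k = Suc k'" "0 < k'"
  obtains q where "block (skip \<eta>) q k'" "stay \<eta> \<circ> bypass q (2 * k') = c \<circ> stay (\<eta> \<circ> c)"
    "\<forall>t<k'. stay \<eta> (q + t) = Suc p + t"
    "\<forall>t<k'. stay \<eta> (q + k' + t) = Suc p + k + t"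
proof -
  have "\<eta> (Suc p) = \<eta> (Suc p - 1)" using block_jump[of "Suc p"] assms by simp
  then obtain q where q: "stay \<eta> q = Suc p" using f stay_obtain by metis
  have q0: "0 < q" using q f by (cases q) auto
  have "\<eta> (p - 1) = \<eta> (p - 1 - 1)" using block_stay_before[of "p - 1"] block_pos by simp
  then obtain j where j: "stay \<eta> j = p - 1" using f stay_obtain by metis
  have "stay \<eta> (Suc j) = Suc p"
  proof (rule stay_Suc_eqI[OF f])
    show "stay \<eta> j < Suc p" "\<eta> (Suc p) = \<eta> (Suc p - 1)" using j \<open>\<eta> (Suc p) = \<eta> (Suc p - 1)\<close> by auto
    fix y assume "stay \<eta> j < y" "y < Suc p"
    then have "y = p" using j by simp
    then show "\<eta> y \<noteq> \<eta> (y - 1)" using block_jump[of p] block_pos by simp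
  qed
  then have "Suc j = q" using q f by (metis stay_eq)
  then have q1: "stay \<eta> (q - 1) = p - 1" using j by auto
  have before: "stay \<eta> (q - 1 - t) = p - 1 - t" if "t < k" for t
    using that
  proof (induction t)
    case (Suc t)
    show ?case
    proof (cases "p - 1 - t = 0")
      \<comment> \<open>The sites of the leading run may be exhausted before \<open>t\<close>
        reaches \<open>k\<close>; from then on both truncated subtractions stay at 0.\<close>
      case True
      then have "q - 1 - t = 0" using Suc f by (metis Suc_lessD stay_eq stay_0)
      then show ?thesis using True f by simp
    next
      case False
      then have "\<eta> (p - 1 - Suc t) = \<eta> (p - 1 - Suc t - 1)"
        using Suc.prems by (intro block_stay_before) auto
      then obtain i where i: "stay \<eta> i = p - 1 - Suc t" using f stay_obtain by metis
      have "stay \<eta> (Suc i) = p - 1 - t"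
        using i False Suc.prems by (intro stay_Suc_eqI[OF f] block_stay_before) auto
      then have "Suc i = q - 1 - t" using Suc f by (metis Suc_lessD stay_eq)
      then have "q - 1 - Suc t = i" by simp
      then show ?thesis using i by simp
    qed
  qed (use q1 in simp)
  have first: "stay \<eta> (q + t) = Suc p + t" if "t < k'" for t
    using that
  proof (induction t)
    case (Suc t)
    then show ?case
      using block_jump[of "Suc p + Suc t"] assms by (auto intro!: stay_Suc_eqI[OF f])
  qed (use q in simp)
  have mid: "stay \<eta> (q + k') = Suc p + k"
  proof -
    have "stay \<eta> (Suc (q + (k' - 1))) = Suc p + k"
    proof (rule stay_Suc_eqI[OF f])
      have s: "stay \<eta> (q + (k' - 1)) = p + k'" using first[of "k' - 1"] assms by simp
      then show "stay \<eta> (q + (k' - 1)) < Suc p + k" using assms by simp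
      show "\<eta> (Suc p + k) = \<eta> (Suc p + k - 1)" using block_jump[of "Suc p + k"] assms by simp
      fix y assume "stay \<eta> (q + (k' - 1)) < y" "y < Suc p + k"
      then have "y = p + k" using s assms by simp
      then show "\<eta> y \<noteq> \<eta> (y - 1)" using block_jump[of y] block_pos by simp
    qed
    then show ?thesis using assms by simp
  qed
  have second: "stay \<eta> (q + k' + t) = Suc p + k + t" if "t < k'" for t
    using that
  proof (induction t)
    case (Suc t)
    then show ?case
      using block_jump[of "Suc p + k + Suc t"] assms by (auto intro!: stay_Suc_eqI[OF f])
  qed (use mid in simp)
  have blk: "block (skip \<eta>) q k'"
    unfolding block_def
  proof (intro conjI allI impI)
    fix y
    {
      assume y: "q - Suc k' \<le> y \<and> y < q"
      then have "stay \<eta> y = p - 1 - (q - 1 - y)" using before[of "q - 1 - y"] assms by fastforce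
      moreover have "p - Suc k \<le> p - 1 - (q - 1 - y)" using y assms by linarith
      ultimately have "\<eta> (stay \<eta> y) = \<eta> (p - 1)"
        using block_before[of "stay \<eta> y"] block_pos by simp
      then show "skip \<eta> y = skip \<eta> (q - 1)" using q1 by (simp add: skip_apply)
    next
      assume "q \<le> y \<and> y < q + k'"
      then obtain t where t: "y = q + t" "t < k'" by (auto simp: le_iff_add)
      have "\<eta> (Suc p + t) \<noteq> \<eta> (p - 1)" using t assms by (intro block_first) auto
      then show "skip \<eta> y \<noteq> skip \<eta> (q - 1)" using first t q1 by (simp add: skip_apply)
    next
      assume "q + k' \<le> y \<and> y < q + 2 * k'"
      then obtain t where t: "y = q + k' + t" "t < k'" by (auto simp: le_iff_add)
      have "\<eta> (Suc p + k + t) = \<eta> (p - 1)" using t assms by (intro block_second) auto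
      then show "skip \<eta> y = skip \<eta> (q - 1)" using second t q1 by (simp add: skip_apply)
    }
  qed (use q0 assms in auto)
  \<comment> \<open>Both maps are increasing, and both enumerate the repeats of
    \<open>\<eta>\<close> that lie outside the block.\<close>
  have comm: "stay \<eta> \<circ> bypass q (2 * k') = c \<circ> stay (\<eta> \<circ> c)"
  proof (rule strict_mono_range_unique)
    show "strict_mono (stay \<eta> \<circ> bypass q (2 * k'))"
      by (intro strict_mono_o strict_mono_bypass strict_mono_stay f)
    show "strict_mono (c \<circ> stay (\<eta> \<circ> c))"
      by (intro strict_mono_o strict_mono_bypass strict_mono_stay finconf_bypass)
    have l: "i < q \<longleftrightarrow> stay \<eta> i < p" for i
    proof -
      have "i < q \<longleftrightarrow> i \<le> q - 1" using q0 by auto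
      also have "\<dots> \<longleftrightarrow> stay \<eta> i \<le> p - 1" using f q1 by (metis stay_le)
      finally show ?thesis using block_pos by auto
    qed
    have r: "q + 2 * k' \<le> i \<longleftrightarrow> p + 2 * k \<le> stay \<eta> i" for i
    proof -
      have "q + 2 * k' \<le> i \<longleftrightarrow> q + k' + (k' - 1) < i" using assms by auto
      also have "\<dots> \<longleftrightarrow> Suc p + k + (k' - 1) < stay \<eta> i"
        using f second[of "k' - 1"] assms by (metis diff_less less_numeral_extra(1) stay_less)
      finally show ?thesis using assms by auto
    qed
    have "range (stay \<eta> \<circ> bypass q (2 * k')) = stay \<eta> ` {i. stay \<eta> i \<in> range c}"
      unfolding image_comp[symmetric] range_bypass l r by simp
    also have "\<dots> = {x. x \<in> range (stay \<eta>) \<and> x \<in> range c}" by auto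
    also have "\<dots> = {x. \<eta> x = \<eta> (x - 1) \<and> x \<in> range c}" by (simp only: range_stay[OF f] mem_Collect_eq)
    finally show "range (stay \<eta> \<circ> bypass q (2 * k')) = range (c \<circ> stay (\<eta> \<circ> c))"
      unfolding image_comp[symmetric] range_stay[OF finconf_bypass] bypass_stay_image .
  qed
  show thesis by (rule that[OF blk comm]) (use first second in blast)+
qed

end

text \<open>Deletion removes \<open>p\<close> and \<open>p + k\<close> from a block of size
  \<open>k\<close>, and these are exactly the sites that \<open>lift\<close> puts back.\<close>

lemma sol_block: "finconf \<eta> \<Longrightarrow> block \<eta> p k \<Longrightarrow> sol \<eta> [p..<p + k] [p + k..<p + 2 * k]"
proof (induction k arbitrary: \<eta> p)
  case 0
  then show ?case by (simp add: block_def)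
next
  case (Suc k)
  note b = block_pos[OF Suc.prems] block_jump[OF Suc.prems] block_stay_before[OF Suc.prems]
  show ?case
  proof (cases "k = 0")
    case True
    show ?thesis using block_odd[OF Suc.prems] sol.unit[of \<eta> p] b(1) b(3)[of "Suc p"] True by simp
  next
    case False
    then obtain q where q: "block (skip \<eta>) q k" 
        "\<forall>t<k. stay \<eta> (q + t) = Suc p + t"
        "\<forall>t<k. stay \<eta> (q + k + t) = Suc p + Suc k + t"
      using block_skip[OF Suc.prems refl] by (metis gr0I)
    have "sol (skip \<eta>) [q..<q + k] [q + k..<q + 2 * k]"
      using Suc.IH q(1) finconf_skip Suc.prems by blast
    from sol.lift[OF this] have "sol \<eta> ((stay \<eta> q - 1) # map (stay \<eta>) [q..<q + k])
        ((stay \<eta> (q + k) - 1) # map (stay \<eta>) [q + k..<q + 2 * k])"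
      using False by simp
    moreover have "map (stay \<eta>) [q..<q + k] = [Suc p..<p + Suc k]"
      by (rule nth_equalityI) (auto simp: q(2) simp del: upt_Suc)
    moreover have "map (stay \<eta>) [q + k..<q + 2 * k] = [Suc (p + Suc k)..<p + 2 * Suc k]"
      by (rule nth_equalityI) (auto simp: q(3) simp del: upt_Suc)
    moreover have "stay \<eta> q - 1 = p" "stay \<eta> (q + k) - 1 = p + Suc k"
      using q(2,3) False by fastforce+
    ultimately show ?thesis by (simp add: upt_conv_Cons del: upt_Suc)
  qed
qed

text \<open>Since cutting commutes with deletion, a soliton of the cut configuration can be
  reassembled in \<open>\<eta>\<close> level by level. At the bottom level no pair is torn apart by
  the cut, because \<open>p - 1\<close> is a repeat. The equation for \<open>\<theta>\<close> frees
  the induction from the shape of the cut configuration.\<close>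

lemma sol_map_bypass:
  assumes "sol \<theta> as bs"
  shows "finconf \<eta> \<Longrightarrow> block \<eta> p k \<Longrightarrow> \<theta> = \<eta> \<circ> bypass p (2 * k) \<Longrightarrow>
    sol \<eta> (map (bypass p (2 * k)) as) (map (bypass p (2 * k)) bs)"
  using assms
proof (induction arbitrary: \<eta> p k rule: sol.induct)
  case (unit \<theta> x)
  note b = block_pos[OF unit.prems(1,2)] block_stay_before[OF unit.prems(1,2)]
  have o: "odd_jump \<eta> (bypass p (2 * k) x)" using unit bypass_odd_jump by blast
  have "Suc x \<noteq> p"
    using o b(3)[of x] b(2) odd_jump_jump by (fastforce simp: bypass_def)
  then have s: "bypass p (2 * k) (Suc x) = Suc (bypass p (2 * k) x)" by (auto simp: bypass_def)
  have "sol \<eta> [bypass p (2 * k) x] [Suc (bypass p (2 * k) x)]"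
    using o unit by (intro sol.unit) (auto simp flip: s)
  then show ?case using s by simp
next
  case (lift \<theta> as bs)
  let ?c = "bypass p (2 * k)"
    have f: "finconf \<theta>" using finconf_bypass[OF lift.prems(1,2)] by (simp only: lift.prems)
  then have i: "as \<noteq> []" "bs \<noteq> []" "skip \<theta> (hd as) \<noteq> skip \<theta> (hd as - 1)" "skip \<theta> (hd bs) \<noteq> skip \<theta> (hd bs - 1)"
    using sol_invariant[OF lift.hyps finconf_skip] by auto
  have h: "?c (stay \<theta> (hd as) - 1) = ?c (stay \<theta> (hd as)) - 1"
    "?c (stay \<theta> (hd bs) - 1) = ?c (stay \<theta> (hd bs)) - 1"
    using bypass_head[OF lift.prems(1,2)] i lift.prems(3) by blast+
  \<comment> \<open>The relabelling one level down: the identity if the block has vanished,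
    otherwise the cut of the smaller block.\<close>
  have "\<exists>g. stay \<eta> \<circ> g = ?c \<circ> stay \<theta> \<and> sol (skip \<eta>) (map g as) (map g bs)"
  proof (cases "k = 1")
    case True
    then have s: "stay \<eta> = ?c \<circ> stay \<theta>"
      unfolding lift.prems(3) by (intro block_1_stay[OF lift.prems(1,2)])
    then have "skip \<eta> = skip \<theta>" by (simp add: skip_def o_assoc flip: lift.prems(3))
    then show ?thesis using lift.hyps s by (intro exI[of _ id]) simp
  next
    case False
    then obtain k' where k': "k = Suc k'" "0 < k'"
      using block_pos[OF lift.prems(1,2)] by (cases k) auto
    obtain q where q: "block (skip \<eta>) q k'" "stay \<eta> \<circ> bypass q (2 * k') = ?c \<circ> stay \<theta>"
      using block_skip[OF lift.prems(1,2) k'] lift.prems(3) by metis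
    have "skip \<theta> = skip \<eta> \<circ> bypass q (2 * k')"
      using fun_cong[OF q(2)] unfolding lift.prems(3) by (simp add: fun_eq_iff skip_apply)
    then show ?thesis using lift.IH q finconf_skip lift.prems by blast
  qed
  then obtain g where g: "stay \<eta> \<circ> g = ?c \<circ> stay \<theta>" "sol (skip \<eta>) (map g as) (map g bs)" by blast
  have g1: "stay \<eta> (g x) = ?c (stay \<theta> x)" for x using g(1) by (metis o_apply)
  show ?case
    using sol.lift[OF g(2)] h i by (simp add: hd_map g1 o_def)
qed

text \<open>Converse to the two preceding lemmas: no soliton meets the block partially. The same
  commutation is read in the opposite direction.\<close>

lemma sol_outside_block:
  assumes "sol \<eta> as bs" "finconf \<eta>" "block \<eta> p k"
  shows "as = [p..<p + k] \<and> bs = [p + k..<p + 2 * k] \<or>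
    (\<exists>as' bs'. sol (\<eta> \<circ> bypass p (2 * k)) as' bs' \<and>
       as = map (bypass p (2 * k)) as' \<and> bs = map (bypass p (2 * k)) bs')"
  using assms
proof (induction arbitrary: p k rule: sol.induct)
  case (unit \<eta> x)
  let ?c = "bypass p (2 * k)"
  note b = block_pos[OF unit.prems] block_stay_before[OF unit.prems] block_jump[OF unit.prems]
  have x: "\<eta> x \<noteq> \<eta> (x - 1)" using unit odd_jump_jump by blast
  \<comment> \<open>A 1-soliton consists of two adjacent jumps. Inside the block the only jumps are
    \<open>p\<close> and \<open>p + k\<close>, so touching it forces \<open>k = 1\<close>, and then
    \<open>x = p\<close> because \<open>Suc p\<close> is not an odd jump.\<close>
  consider "x = p" "k = 1" | "x < p \<or> p + 2 * k \<le> x" "Suc x \<noteq> p"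
  proof -
    have "Suc x \<noteq> p" using x b(3)[of x] b(2) by force
    moreover have "x = p \<and> k = 1" if "\<not> (x < p \<or> p + 2 * k \<le> x)"
    proof -
      have 1: "x = p \<or> x = p + k" using b(4)[of x] x that by simp
      have "k = 1"
      proof (rule ccontr)
        assume "k \<noteq> 1"
        then show False using 1 b(4)[of "Suc x"] b(2) unit(2) by auto
      qed
      moreover have "x \<noteq> Suc p"
        using block_odd[OF unit.prems] unit(1) by auto
      ultimately show ?thesis using 1 by auto
    qed
    ultimately show ?thesis using that by blast
  qed
  then show ?case
  proof cases
    case 2
    then obtain y where y: "x = ?c y" using range_bypass[of p "2 * k"] by blast
    then have s: "?c (Suc y) = Suc x" using 2 by (auto simp: bypass_def split: if_splits)
    have "sol (\<eta> \<circ> ?c) [y] [Suc y]"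
      using unit y s by (intro sol.unit) (simp_all add: bypass_odd_jump[OF unit.prems])
    then show ?thesis using y s by fastforce
  qed simp
next
  case (lift \<eta> as bs)
  let ?c = "bypass p (2 * k)"
  let ?t = "\<eta> \<circ> ?c"
  have f: "finconf ?t" using finconf_bypass lift.prems by simp
  have reduce: ?case if "sol (skip ?t) as' bs'" "as = map g as'" "bs = map g bs'"
    "stay \<eta> \<circ> g = ?c \<circ> stay ?t" for g as' bs'
  proof -
    have i: "as' \<noteq> []" "bs' \<noteq> []" "skip ?t (hd as') \<noteq> skip ?t (hd as' - 1)"
      "skip ?t (hd bs') \<noteq> skip ?t (hd bs' - 1)"
      using sol_invariant[OF that(1) finconf_skip[OF f]] by auto
    have h: "?c (stay ?t (hd as') - 1) = ?c (stay ?t (hd as')) - 1"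
      "?c (stay ?t (hd bs') - 1) = ?c (stay ?t (hd bs')) - 1"
      using bypass_head[OF lift.prems] i by simp_all
    have g1: "stay \<eta> (g x) = ?c (stay ?t x)" for x using that(4) by (metis o_apply)
    show ?thesis
      by (rule disjI2, intro exI conjI, rule sol.lift[OF that(1)])
        (use i h that(2,3) in \<open>simp_all add: hd_map g1 o_def\<close>)
  qed
  show ?case
  proof (cases "k = 1")
    case True
    then have s: "stay \<eta> = ?c \<circ> stay ?t" using block_1_stay lift.prems by simp
    then have "skip \<eta> = skip ?t" by (simp add: skip_def o_assoc)
    then show ?thesis using reduce[of as bs id] lift.hyps s by simp
  next
    case False
    then obtain k' where k': "k = Suc k'" "0 < k'"
      using block_pos[OF lift.prems] by (cases k) auto
    obtain q where q: "block (skip \<eta>) q k'" "stay \<eta> \<circ> bypass q (2 * k') = ?c \<circ> stay ?t"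
        "\<forall>t<k'. stay \<eta> (q + t) = Suc p + t"
        "\<forall>t<k'. stay \<eta> (q + k' + t) = Suc p + k + t"
      using block_skip[OF lift.prems k'] by metis
    have sk: "skip ?t = skip \<eta> \<circ> bypass q (2 * k')"
      using q(2) by (simp add: skip_def o_assoc[symmetric])
    from lift.IH[OF finconf_skip[OF lift.prems(1)] q(1)] show ?thesis
    proof
      assume ab: "as = [q..<q + k'] \<and> bs = [q + k'..<q + 2 * k']"
      have "map (stay \<eta>) [q..<q + k'] = [Suc p..<p + k]"
        by (rule nth_equalityI) (auto simp: q(3) k' simp del: upt_Suc)
      moreover have "map (stay \<eta>) [q + k'..<q + 2 * k'] = [Suc (p + k)..<p + 2 * k]"
        by (rule nth_equalityI) (auto simp: q(4) k' simp del: upt_Suc)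
      moreover have "stay \<eta> q - 1 = p" "stay \<eta> (q + k') - 1 = p + k"
        using q(3,4) k' by fastforce+
      ultimately show ?thesis using ab k' by (simp add: upt_conv_Cons del: upt_Suc)
    next
      assume "\<exists>as' bs'. sol (skip \<eta> \<circ> bypass q (2 * k')) as' bs' \<and>
         as = map (bypass q (2 * k')) as' \<and> bs = map (bypass q (2 * k')) bs'"
      then obtain as' bs' where "sol (skip ?t) as' bs'"
        "as = map (bypass q (2 * k')) as'" "bs = map (bypass q (2 * k')) bs'"
        unfolding sk by blast
      then show ?thesis using q(2) by (rule reduce)
    qed
  qed
qed

subsection \<open>The Takahashi-Satsuma algorithm\<close>

context
  fixes f :: "nat \<Rightarrow> nat"
  assumes mono: "strict_mono f" and zero: "f 0 = 0"
begin

lemma inj_mono: "inj_on f A"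
  using mono strict_mono_imp_inj_on inj_on_subset by blast

text \<open>Every notion of the algorithm involves only the order of the uncrossed sites, their
  letters, cardinalities and membership of 0, so each one is transported along \<open>f\<close> in
  turn.\<close>

lemma uncrossed_string_image:
  "uncrossed_string \<eta> (f ` V) (f ` S) \<longleftrightarrow> uncrossed_string (\<eta> \<circ> f) V S"
  unfolding uncrossed_string_def using inj_mono[of UNIV]
  by (simp only: inj_image_subset_iff inj_image_mem_iff ball_simps strict_mono_less_eq[OF mono] image_is_empty o_apply)

lemma is_run_image: "is_run \<eta> (f ` V) (f ` R) \<longleftrightarrow> is_run (\<eta> \<circ> f) V R"
proof -
  have "(\<forall>S. uncrossed_string \<eta> (f ` V) S \<and> f ` R \<subseteq> S \<longrightarrow> S = f ` R) \<longleftrightarrow>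
    (\<forall>S. uncrossed_string \<eta> (f ` V) (f ` S) \<and> f ` R \<subseteq> f ` S \<longrightarrow> f ` S = f ` R)"
    (is "?l \<longleftrightarrow> ?r")
  proof
    assume r: ?r
    show ?l
    proof (intro allI impI)
      fix S assume S: "uncrossed_string \<eta> (f ` V) S \<and> f ` R \<subseteq> S"
      \<comment> \<open>A competing string consists of uncrossed sites and is therefore itself an
        image.\<close>
      then obtain S' where "S = f ` S'" unfolding uncrossed_string_def by (meson subset_imageE)
      then show "S = f ` R" using r S by simp
    qed
  qed simp
  then show ?thesis
    unfolding is_run_def uncrossed_string_image
    using inj_mono[of UNIV] by (simp add: inj_image_subset_iff inj_image_eq_iff)
qed

lemma run_length_image: "run_length (f ` R) = run_length R"
proof -
  have "0 \<in> f ` R \<longleftrightarrow> 0 \<in> R" using inj_image_mem_iff[OF inj_mono] zero by metis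
  then show ?thesis by (simp add: run_length_def finite_image_iff card_image inj_mono)
qed

lemma selectable_image:
  "selectable \<eta> (f ` V) (f ` P) (f ` R) \<longleftrightarrow> selectable (\<eta> \<circ> f) V P R"
  by (simp add: selectable_def preceding_run_def run_length_image is_run_image strict_mono_less[OF mono])

lemma selectable_imageE:
  assumes "selectable \<eta> (f ` V) P R"
  obtains P' R' where "P = f ` P'" "R = f ` R'"
  using assms unfolding selectable_def preceding_run_def is_run_def uncrossed_string_def
  by (metis subset_imageE)

lemma selected_image:
  "selected \<eta> (f ` V) (f ` P) (f ` R) \<longleftrightarrow> selected (\<eta> \<circ> f) V P R"
proof -
  have "(\<forall>P' R'. selectable \<eta> (f ` V) P' R' \<longrightarrow> R' = f ` R \<or> (\<forall>x\<in>f ` R. \<forall>y\<in>R'. x < y)) \<longleftrightarrow>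
    (\<forall>P' R'. selectable \<eta> (f ` V) (f ` P') (f ` R') \<longrightarrow> f ` R' = f ` R \<or> (\<forall>x\<in>f ` R. \<forall>y\<in>f ` R'. x < y))"
    (is "?l \<longleftrightarrow> ?r")
  proof
    assume r: ?r
    show ?l
    proof (intro allI impI)
      fix P' R' assume s: "selectable \<eta> (f ` V) P' R'"
      then obtain P'' R'' where "P' = f ` P''" "R' = f ` R''" by (rule selectable_imageE)
      then show "R' = f ` R \<or> (\<forall>x\<in>f ` R. \<forall>y\<in>R'. x < y)" using r s by blast
    qed
  qed blast
  then show ?thesis
    unfolding selected_def selectable_image using inj_mono[of UNIV]
    by (simp add: inj_image_eq_iff strict_mono_less[OF mono])
qed

lemma letters_image:
  "first_letters k (f ` R) = f ` first_letters k R"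
  "last_letters k (f ` R) = f ` last_letters k R"
proof -
  have "card {y \<in> f ` R. y < f x} = card {y \<in> R. y < x}" for x
  proof -
    have "{y \<in> f ` R. y < f x} = f ` {y \<in> R. y < x}"
      using strict_mono_less[OF mono] by auto
    then show ?thesis by (simp add: card_image inj_mono)
  qed
  moreover have "card {y \<in> f ` R. f x < y} = card {y \<in> R. x < y}" for x
  proof -
    have "{y \<in> f ` R. f x < y} = f ` {y \<in> R. x < y}"
      using strict_mono_less[OF mono] by auto
    then show ?thesis by (simp add: card_image inj_mono)
  qed
  ultimately show "first_letters k (f ` R) = f ` first_letters k R"
    "last_letters k (f ` R) = f ` last_letters k R"
    unfolding first_letters_def last_letters_def by auto
qed

lemma ts_step_image:
  "ts_step \<eta> (f ` V) k \<gamma> \<longleftrightarrow> (\<exists>\<gamma>'. ts_step (\<eta> \<circ> f) V k \<gamma>' \<and> \<gamma> = f ` \<gamma>')"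
proof
  assume "ts_step \<eta> (f ` V) k \<gamma>"
  then obtain P R where 1: "\<exists>x\<in>f ` V. \<eta> x = 1" "selected \<eta> (f ` V) P R" "run_length P = enat k"
    "\<gamma> = first_letters k R \<union> last_letters k P" by (auto simp: ts_step_def)
  have "selectable \<eta> (f ` V) P R" using 1(2) by (simp add: selected_def)
  then obtain P' R' where PR: "P = f ` P'" "R = f ` R'" by (rule selectable_imageE)
  have "ts_step (\<eta> \<circ> f) V k (first_letters k R' \<union> last_letters k P')"
    using 1(1-3) unfolding ts_step_def PR selected_image run_length_image by auto
  moreover have "\<gamma> = f ` (first_letters k R' \<union> last_letters k P')"
    using 1(4) by (simp add: PR letters_image image_Un)
  ultimately show "\<exists>\<gamma>'. ts_step (\<eta> \<circ> f) V k \<gamma>' \<and> \<gamma> = f ` \<gamma>'" by blast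
next
  assume "\<exists>\<gamma>'. ts_step (\<eta> \<circ> f) V k \<gamma>' \<and> \<gamma> = f ` \<gamma>'"
  then obtain P R where "\<exists>x\<in>V. \<eta> (f x) = 1" "selected (\<eta> \<circ> f) V P R" "run_length P = enat k"
    "\<gamma> = f ` (first_letters k R \<union> last_letters k P)" by (auto simp: ts_step_def)
  then have "\<exists>x\<in>f ` V. \<eta> x = 1" "selected \<eta> (f ` V) (f ` P) (f ` R)" "run_length (f ` P) = enat k"
    "\<gamma> = first_letters k (f ` R) \<union> last_letters k (f ` P)"
    by (simp_all add: selected_image run_length_image letters_image image_Un)
  then show "ts_step \<eta> (f ` V) k \<gamma>" unfolding ts_step_def by blast
qed

end

section \<open>Runs before anything is crossed out, and the first step\<close>

definition run_of :: "(nat \<Rightarrow> int) \<Rightarrow> nat \<Rightarrow> nat set" where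
  "run_of \<eta> x = {y. \<forall>z. x \<le> z \<and> z \<le> y \<or> y \<le> z \<and> z \<le> x \<longrightarrow> \<eta> z = \<eta> x}"

lemma run_of_self: "x \<in> run_of \<eta> x"
  unfolding run_of_def using le_antisym by blast

lemma run_of_value: "y \<in> run_of \<eta> x \<Longrightarrow> \<eta> y = \<eta> x"
  unfolding run_of_def using le_cases by blast

lemma run_of_convex:
  assumes "x \<in> run_of \<eta> a" "z \<in> run_of \<eta> a" "x \<le> y" "y \<le> z"
  shows "y \<in> run_of \<eta> a"
  unfolding run_of_def
proof (intro CollectI allI impI)
  fix w assume w: "a \<le> w \<and> w \<le> y \<or> y \<le> w \<and> w \<le> a"
  then have "a \<le> w \<and> w \<le> z \<or> x \<le> w \<and> w \<le> a" using assms by linarith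
  then show "\<eta> w = \<eta> a" using assms unfolding run_of_def by blast
qed

lemma uncrossed_string_run_of: "uncrossed_string \<eta> UNIV (run_of \<eta> x)"
  unfolding uncrossed_string_def
  using run_of_self run_of_value run_of_convex by (metis empty_iff subset_UNIV)

lemma uncrossed_string_subset:
  assumes "uncrossed_string \<eta> UNIV S" "x \<in> S"
  shows "S \<subseteq> run_of \<eta> x"
proof
  fix y assume y: "y \<in> S"
  show "y \<in> run_of \<eta> x"
    unfolding run_of_def
  proof (intro CollectI allI impI)
    fix z assume "x \<le> z \<and> z \<le> y \<or> y \<le> z \<and> z \<le> x"
    then have "z \<in> S" using assms y unfolding uncrossed_string_def by blast
    then show "\<eta> z = \<eta> x" using assms unfolding uncrossed_string_def by blast
  qed
qed

lemma is_run_eq: "is_run \<eta> UNIV R \<Longrightarrow> x \<in> R \<Longrightarrow> R = run_of \<eta> x"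
  unfolding is_run_def using uncrossed_string_run_of uncrossed_string_subset by metis

lemma is_run_run_of: "is_run \<eta> UNIV (run_of \<eta> x)"
  unfolding is_run_def
proof (intro conjI allI impI)
  show "uncrossed_string \<eta> UNIV (run_of \<eta> x)" by (rule uncrossed_string_run_of)
  fix S assume "uncrossed_string \<eta> UNIV S \<and> run_of \<eta> x \<subseteq> S"
  then show "S = run_of \<eta> x" using uncrossed_string_subset run_of_self by (metis subset_antisym subsetD)
qed

lemma is_run_convex:
  "is_run \<eta> UNIV R \<Longrightarrow> x \<in> R \<Longrightarrow> z \<in> R \<Longrightarrow> x \<le> y \<Longrightarrow> y \<le> z \<Longrightarrow> y \<in> R"
  using is_run_eq run_of_convex by metis

lemma is_run_value: "is_run \<eta> UNIV R \<Longrightarrow> x \<in> R \<Longrightarrow> y \<in> R \<Longrightarrow> \<eta> x = \<eta> y"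
  using is_run_eq run_of_value by metis

lemma is_run_extend:
  assumes "is_run \<eta> UNIV R" "x \<in> R" "y = Suc x \<or> x = Suc y" "\<eta> y = \<eta> x"
  shows "y \<in> R"
proof -
  have "y \<in> run_of \<eta> x" using assms(3,4) unfolding run_of_def by (auto simp: le_Suc_eq)
  then show ?thesis using is_run_eq assms(1,2) by blast
qed

lemma is_run_nonempty: "is_run \<eta> U R \<Longrightarrow> R \<noteq> {}"
  by (simp add: is_run_def uncrossed_string_def)

text \<open>The assumption \<open>0 < a\<close> excludes the leading run, whose length is infinite
  by convention even if it has finitely many elements.\<close>

lemma run_length_initial_segment:
  assumes R: "is_run \<eta> UNIV R" and "a \<in> R" "0 < a" "\<forall>x\<in>R. a \<le> x" "enat k \<le> run_length R"
  shows "{a..<a + k} \<subseteq> R"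
proof (rule ccontr)
  assume "\<not> {a..<a + k} \<subseteq> R"
  then obtain y where y: "a \<le> y" "y < a + k" "y \<notin> R" by (meson atLeastLessThan_iff subsetI)
  have "R \<subseteq> {a..<y}"
  proof
    fix x assume x: "x \<in> R"
    then show "x \<in> {a..<y}"
      using is_run_convex[OF R \<open>a \<in> R\<close> x y(1)] y(3) assms(4) by (cases "y \<le> x") auto
  qed
  then have "finite R" "card R \<le> y - a" using finite_subset card_mono[of "{a..<y}" R] by auto
  then have "run_length R = enat (card R)" using assms(3,4) by (auto simp: run_length_def)
  then show False using assms(5) \<open>card R \<le> y - a\<close> y by simp
qed

lemma run_length_final_segment:
  assumes R: "is_run \<eta> UNIV R" and "p \<in> R" "\<forall>x\<in>R. x \<le> p" "enat k < run_length R"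
    and y: "p - k \<le> y" "y \<le> p"
  shows "y \<in> R"
proof (rule ccontr)
  assume "y \<notin> R"
  then have "R \<subseteq> {y<..p}"
    using is_run_convex[OF R _ assms(2), of _ y] assms(3) y(2) by (force simp: not_le[symmetric])
  then have "finite R" "card R \<le> p - y" "0 \<notin> R"
    using finite_subset card_mono[of "{y<..p}" R] by auto
  then show False using assms(4) y by (simp add: run_length_def)
qed

lemma preceding_run_adjacent:
  assumes "preceding_run \<eta> UNIV P R"
  obtains q where "q \<in> P" "Suc q \<in> R" "\<forall>x\<in>P. x \<le> q" "\<forall>x\<in>R. q < x"
proof -
  have ne: "P \<noteq> {}" "R \<noteq> {}" and lt: "\<forall>x\<in>P. \<forall>y\<in>R. x < y"
    and nb: "\<not> (\<exists>z. (\<forall>x\<in>P. x < z) \<and> (\<forall>y\<in>R. z < y))"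
    using assms is_run_nonempty by (auto simp: preceding_run_def)
  have fin: "finite P" using lt ne by (meson bounded_nat_set_is_finite ex_in_conv)
  have q: "Max P \<in> P" "\<forall>x\<in>P. x \<le> Max P" using fin ne by simp_all
  have "Suc (Max P) \<in> R"
  proof (rule ccontr)
    assume "Suc (Max P) \<notin> R"
    then have "\<forall>y\<in>R. Suc (Max P) < y" using lt q(1) by (metis Suc_lessI)
    moreover have "\<forall>x\<in>P. x < Suc (Max P)" using q(2) by (simp add: le_imp_less_Suc)
    ultimately show False using nb by blast
  qed
  then show ?thesis using that q lt by blast
qed

lemma preceding_run_intro:
  assumes "\<eta> (Suc q) \<noteq> \<eta> q"
  shows "preceding_run \<eta> UNIV (run_of \<eta> q) (run_of \<eta> (Suc q))"
proof -
  have "x \<le> q" if "x \<in> run_of \<eta> q" for x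
    using that assms run_of_convex[OF run_of_self that, of "Suc q"] run_of_value by (metis not_less_eq_eq le_SucI le_refl nat_le_linear)
  moreover have "q < x" if "x \<in> run_of \<eta> (Suc q)" for x
    using that assms run_of_convex[OF that run_of_self, of q] run_of_value by (metis not_le le_SucI le_refl)
  ultimately show ?thesis
    using run_of_self[of q \<eta>] run_of_self[of "Suc q" \<eta>] unfolding preceding_run_def
    by (auto simp: is_run_run_of) (meson le_less_trans not_less_eq not_le less_imp_not_less le_imp_less_Suc)+
qed

text \<open>Leftmost choice is applied to the pair just before the selected one: the run
  \<open>P\<close> lies to the left of \<open>R\<close>, so it is not selectable, and hence the run
  before \<open>P\<close> is longer than \<open>P\<close>. This is the local pattern
  \<open>block\<close>.\<close>

lemma ts_step_block:
  assumes f: "finconf \<eta>" and "ts_step \<eta> UNIV k \<gamma>"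
  obtains p where "block \<eta> p k" "\<gamma> = {p..<p + 2 * k}"
proof -
  obtain P R where sel: "selected \<eta> UNIV P R" and lP: "run_length P = enat k"
    and g: "\<gamma> = first_letters k R \<union> last_letters k P"
    using assms by (auto simp: ts_step_def)
  have prec: "preceding_run \<eta> UNIV P R" and le: "run_length P \<le> run_length R"
    using sel by (auto simp: selected_def selectable_def)
  then have P: "is_run \<eta> UNIV P" and R: "is_run \<eta> UNIV R" by (auto simp: preceding_run_def)
  obtain q where q: "q \<in> P" "Suc q \<in> R" "\<forall>x\<in>P. x \<le> q" "\<forall>x\<in>R. q < x"
    using prec preceding_run_adjacent by blast
  have fin: "finite P" "0 \<notin> P" "card P = k" using lP by (auto simp: run_length_def split: if_splits)
  define p where "p = Min P"
  have p: "p \<in> P" "\<forall>x\<in>P. p \<le> x" using fin q(1) by (auto simp: p_def intro!: Min_in)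
  have p0: "0 < p" using p fin by (metis gr0I)
  have "P = {p..q}"
  proof (intro subset_antisym subsetI)
    show "x \<in> {p..q}" if "x \<in> P" for x using that p(2) q(3) by simp
    show "x \<in> P" if "x \<in> {p..q}" for x using that is_run_convex[OF P p(1) q(1)] by simp
  qed
  then have "k = Suc q - p" using fin(3) by (metis card_atLeastAtMost)
  moreover have "p \<le> q" using p(1) q(3) by simp
  ultimately have qk: "Suc q = p + k" and k0: "0 < k" by auto
  have Pk: "P = {p..<p + k}" using \<open>P = {p..q}\<close> qk by auto
  have Rk: "{p + k..<p + 2 * k} \<subseteq> R"
  proof -
    have "\<forall>x\<in>R. Suc q \<le> x" using q(4) by (simp add: Suc_le_eq)
    then have "{Suc q..<Suc q + k} \<subseteq> R" using run_length_initial_segment[OF R q(2)] le lP by simp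
    then show ?thesis by (simp add: qk mult_2 add.assoc)
  qed
  have jump: "\<eta> p \<noteq> \<eta> (p - 1)" using is_run_extend[OF P p(1), of "p - 1"] p p0 by fastforce
  have jump2: "\<eta> (p + k) \<noteq> \<eta> q" using is_run_extend[OF P q(1), of "p + k"] q(3) qk by fastforce
  have Pv: "\<eta> y = \<eta> p" if "p \<le> y" "y < p + k" for y 
    by (rule is_run_value[OF P _ p(1)]) (simp add: Pk that)
  have Rv: "\<eta> y = \<eta> (p - 1)" if "p + k \<le> y" "y < p + 2 * k" for y
  proof -
    have "y \<in> R" using Rk that by auto
    then have "\<eta> y = \<eta> (p + k)" using is_run_value[OF R] q(2) unfolding qk by blast
    also have "\<eta> q = \<eta> p" using qk k0 by (intro Pv) auto
    then have "\<eta> (p + k) = \<eta> (p - 1)"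
      using jump2 jump finconf_neq[OF f, of "p + k" p "p - 1"] by simp
    finally show ?thesis .
  qed
  let ?Q = "run_of \<eta> (p - 1)"
  have "run_of \<eta> p = P" using is_run_eq[OF P p(1)] by simp
  then have "preceding_run \<eta> UNIV ?Q P"
    using preceding_run_intro[of \<eta> "p - 1"] jump p0 by simp
  moreover have "\<not> selectable \<eta> UNIV ?Q P"
  proof
    assume "selectable \<eta> UNIV ?Q P"
    then have "P = R \<or> (\<forall>x\<in>R. \<forall>y\<in>P. x < y)" using sel by (auto simp: selected_def)
    then show False using q by (metis less_irrefl less_trans)
  qed
  ultimately have lQ: "enat k < run_length ?Q" by (simp add: selectable_def lP)
  have Qv: "\<eta> y = \<eta> (p - 1)" if "p - Suc k \<le> y" "y < p" for y
  proof -
    have "\<forall>x\<in>?Q. x \<le> p - 1"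
      using \<open>preceding_run \<eta> UNIV ?Q P\<close> p(1) by (fastforce simp: preceding_run_def)
    then have "y \<in> ?Q"
      using run_length_final_segment[OF is_run_run_of run_of_self _ lQ, of y] that by auto
    then show ?thesis by (rule run_of_value)
  qed
  have "block \<eta> p k"
    unfolding block_def using p0 k0 Qv Rv Pv jump by metis
  moreover have "\<gamma> = {p..<p + 2 * k}"
  proof -
    have "{y \<in> P. x < y} \<subset> P" if "x \<in> P" for x using that by blast
    then have "card {y \<in> P. x < y} < k" if "x \<in> P" for x
      using that psubset_card_mono[OF fin(1)] fin(3) by metis
    then have "last_letters k P = P" by (auto simp: last_letters_def)
    moreover have "first_letters k R = {p + k..<p + 2 * k}"
    proof -
      have "{y \<in> R. y < x} = {p + k..<x}" if "p + k \<le> x" "x \<le> p + 2 * k" for x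
        using that Rk q(4) qk by (auto simp: subset_iff Suc_le_eq)
      then have c: "card {y \<in> R. y < x} = x - (p + k)" if "p + k \<le> x" "x \<le> p + 2 * k" for x
        using that by simp
      have "x < p + 2 * k" if "x \<in> R" "card {y \<in> R. y < x} < k" for x
      proof (rule ccontr)
        assume "\<not> x < p + 2 * k"
        then have "{y \<in> R. y < p + 2 * k} \<subseteq> {y \<in> R. y < x}" by auto
        then have "card {y \<in> R. y < p + 2 * k} \<le> card {y \<in> R. y < x}" by (intro card_mono) auto
        then show False using c[of "p + 2 * k"] that by simp
      qed
      moreover have "p + k \<le> x" if "x \<in> R" for x using q(4) qk that by fastforce
      moreover have "x \<in> R \<and> card {y \<in> R. y < x} < k" if "x \<in> {p + k..<p + 2 * k}" for x
        using c[of x] Rk that by (simp add: subset_iff less_diff_conv2)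
      ultimately show ?thesis
        unfolding first_letters_def set_eq_iff mem_Collect_eq atLeastLessThan_iff by blast
    qed
    ultimately show ?thesis using g Pk by auto
  qed
  ultimately show ?thesis using that by blast
qed

text \<open>The trailing run of zeros is infinite, hence always selectable, so a candidate with
  smallest element exists; convexity of runs makes it the leftmost one.\<close>

lemma ex_ts_step:
  assumes f: "finconf \<eta>" and x: "\<eta> x \<noteq> 0"
  obtains k \<gamma> where "ts_step \<eta> UNIV k \<gamma>"
proof -
  have fin: "finite {x. \<eta> x \<noteq> 0}" by (rule finite_ones[OF f])
  define M where "M = Max {x. \<eta> x \<noteq> 0}"
  have M: "\<eta> M \<noteq> 0" using Max_in[OF fin] x unfolding M_def by auto
  have z: "\<eta> y = 0" if "M < y" for y using Max_ge[OF fin, of y] that unfolding M_def by (metis mem_Collect_eq not_le)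
  have sub: "{Suc M..} \<subseteq> run_of \<eta> (Suc M)" using z by (auto simp: run_of_def)
  then have "infinite (run_of \<eta> (Suc M))" using infinite_Ici finite_subset by blast
  then have "selectable \<eta> UNIV (run_of \<eta> M) (run_of \<eta> (Suc M))"
    using preceding_run_intro[of \<eta> M] M z[of "Suc M"] by (auto simp: selectable_def run_length_def)
  then have ex: "\<exists>a P R. selectable \<eta> UNIV P R \<and> a \<in> R" using run_of_self by blast
  define a where "a = (LEAST a. \<exists>P R. selectable \<eta> UNIV P R \<and> a \<in> R)"
  obtain P R where PR: "selectable \<eta> UNIV P R" "a \<in> R"
    using LeastI_ex[OF ex] unfolding a_def by blast
  have least: "a \<le> y" if "selectable \<eta> UNIV P' R'" "y \<in> R'" for y P' R'
    unfolding a_def using that by (intro Least_le) blast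
  have R: "is_run \<eta> UNIV R" and P: "is_run \<eta> UNIV P" and prec: "preceding_run \<eta> UNIV P R"
    using PR by (auto simp: selectable_def preceding_run_def)
  have "selected \<eta> UNIV P R"
    unfolding selected_def
  proof (intro conjI allI impI)
    fix P' R' assume s: "selectable \<eta> UNIV P' R'"
    have R': "is_run \<eta> UNIV R'" using s by (auto simp: selectable_def preceding_run_def)
    show "R' = R \<or> (\<forall>x\<in>R. \<forall>y\<in>R'. x < y)"
    proof (rule disjCI)
      assume "\<not> (\<forall>x\<in>R. \<forall>y\<in>R'. x < y)"
      then obtain x y where xy: "x \<in> R" "y \<in> R'" "y \<le> x" by (auto simp: not_less)
      then have "y \<in> R" using is_run_convex[OF R PR(2)] least[OF s] by blast
      then show "R' = R" using is_run_eq[OF R] is_run_eq[OF R'] xy by metis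
    qed
  qed (use PR in blast)
  \<comment> \<open>Otherwise \<open>P\<close> is the leading run and \<open>R\<close> is infinite,
    hence the trailing run. Both carry the letter 0 and are adjacent, so they would be one
    run.\<close>
  moreover have "run_length P \<noteq> \<infinity>"
  proof
    assume inf: "run_length P = \<infinity>"
    obtain q where q: "q \<in> P" "Suc q \<in> R" "\<forall>x\<in>P. x \<le> q" "\<forall>x\<in>R. q < x"
      using prec preceding_run_adjacent by blast
    have "finite P" using q(3) by (meson finite_nat_set_iff_bounded_le)
    then have "0 \<in> P" using inf by (auto simp: run_length_def split: if_splits)
    then have "\<eta> q = 0" using is_run_value[OF P q(1)] finconf_0[OF f] by metis
    have "run_length R = \<infinity>" using PR(1) inf by (simp add: selectable_def)
    then have "infinite R" using q(4) by (auto simp: run_length_def split: if_splits)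
    then obtain y where y: "y \<in> R" "M < y" by (meson finite_nat_set_iff_bounded_le not_le)
    have "\<eta> (Suc q) = 0" using is_run_value[OF R q(2) y(1)] z[OF y(2)] by simp
    then have "Suc q \<in> P" using is_run_extend[OF P q(1)] \<open>\<eta> q = 0\<close> by simp
    then show False using q(3) by fastforce
  qed
  ultimately show ?thesis
    using that M finconf_cases[OF f, of M] unfolding ts_step_def by (metis UNIV_I not_enat_eq)
qed

section \<open>Agreement of the algorithm with the recursion\<close>

text \<open>\<open>ts_uncrossed\<close> appends steps at the end, while the comparison with
  \<open>sol\<close> needs the first one split off. After relabelling, all later steps are steps of
  the configuration with the first block cut out.\<close>

lemma ts_uncrossed_cases:
  assumes f: "finconf \<eta>" and "ts_uncrossed \<eta> U"
  shows "U = UNIV \<or> (\<exists>p k V. block \<eta> p k \<and> ts_uncrossed (\<eta> \<circ> bypass p (2 * k)) V \<and> U = bypass p (2 * k) ` V)"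
  using assms(2)
proof (induction rule: ts_uncrossed.induct)
  case (cross U k \<gamma>)
  from cross.IH show ?case
  proof
    assume "U = UNIV"
    then obtain p where p: "block \<eta> p k" "\<gamma> = {p..<p + 2 * k}"
      using ts_step_block[OF f] cross by blast
    then have "U - \<gamma> = range (bypass p (2 * k))" using \<open>U = UNIV\<close> by (auto simp: range_bypass)
    then show ?thesis using p(1) ts_uncrossed.init by blast
  next
    assume "\<exists>p k V. block \<eta> p k \<and> ts_uncrossed (\<eta> \<circ> bypass p (2 * k)) V \<and> U = bypass p (2 * k) ` V"
    then obtain p l V where l: "block \<eta> p l" "ts_uncrossed (\<eta> \<circ> bypass p (2 * l)) V" "U = bypass p (2 * l) ` V"
      by blast
    have c0: "bypass p (2 * l) 0 = 0" using l(1) by (simp add: bypass_def block_def)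
    obtain \<gamma>' where \<gamma>': "ts_step (\<eta> \<circ> bypass p (2 * l)) V k \<gamma>'" "\<gamma> = bypass p (2 * l) ` \<gamma>'"
      using cross.hyps(2) ts_step_image[OF strict_mono_bypass c0] l(3) by blast
    have "U - \<gamma> = bypass p (2 * l) ` (V - \<gamma>')"
      by (simp add: l(3) \<gamma>'(2) image_set_diff strict_mono_imp_inj_on strict_mono_bypass)
    with l(1) ts_uncrossed.cross[OF l(2) \<gamma>'(1)] show ?thesis by blast
  qed
qed simp

lemma ts_uncrossed_image:
  assumes "ts_step \<eta> UNIV k {p..<p + 2 * k}" "0 < p" "ts_uncrossed (\<eta> \<circ> bypass p (2 * k)) V"
  shows "ts_uncrossed \<eta> (bypass p (2 * k) ` V)"
  using assms(3)
proof (induction rule: ts_uncrossed.induct)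
  case init
  have "UNIV - {p..<p + 2 * k} = range (bypass p (2 * k))" by (auto simp: range_bypass)
  then show ?case using ts_uncrossed.cross[OF ts_uncrossed.init assms(1)] by simp
next
  case (cross V l \<gamma>)
  have "ts_step \<eta> (bypass p (2 * k) ` V) l (bypass p (2 * k) ` \<gamma>)"
    using cross.hyps(2) ts_step_image[OF strict_mono_bypass bypass_0[OF assms(2)]] by blast
  then show ?case
    using ts_uncrossed.cross[OF cross.IH]
    by (simp add: image_set_diff strict_mono_imp_inj_on strict_mono_bypass)
qed

text \<open>In both directions the first step is removed and the claim is used for the cut
  configuration. For a soliton of \<open>sol\<close>, that step is supplied by
  \<open>ex_ts_step\<close>, and \<open>sol_outside_block\<close> says that the soliton either is
  the block or survives the cut.\<close>

lemma soliton_iff: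
  "finconf \<eta> \<Longrightarrow> soliton \<eta> k \<gamma> \<longleftrightarrow> (\<exists>as bs. sol \<eta> as bs \<and> length as = k \<and> \<gamma> = set as \<union> set bs)"
proof (induction "ones \<eta>" arbitrary: \<eta> k \<gamma> rule: less_induct)
  case less
  note f = \<open>finconf \<eta>\<close>
  have IH: "soliton (\<eta> \<circ> bypass p (2 * l)) k \<gamma> \<longleftrightarrow>
      (\<exists>as bs. sol (\<eta> \<circ> bypass p (2 * l)) as bs \<and> length as = k \<and> \<gamma> = set as \<union> set bs)"
    if "block \<eta> p l" for p l k \<gamma>
  proof -
    \<comment> \<open>One of these two crossed-out letters is a one, whichever letter the selected
      run has, so the cut lowers \<open>ones\<close>.\<close>
    have "\<eta> p \<noteq> \<eta> (p + l)"
      using block_first[OF f that, of p] block_second[OF f that, of "p + l"] block_pos[OF f that] by simp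
    moreover have "p \<notin> range (bypass p (2 * l))" "p + l \<notin> range (bypass p (2 * l))"
      using block_pos[OF f that] unfolding range_bypass by simp_all
    ultimately obtain x where "\<eta> x \<noteq> 0" "x \<notin> range (bypass p (2 * l))" by metis
    then show ?thesis
      using less.hyps ones_comp[OF f strict_mono_bypass] finconf_bypass[OF f that] by blast
  qed
  show ?case
  proof
    assume "soliton \<eta> k \<gamma>"
    then obtain U where U: "ts_uncrossed \<eta> U" "ts_step \<eta> U k \<gamma>" by (auto simp: soliton_def)
    from ts_uncrossed_cases[OF f U(1)]
    show "\<exists>as bs. sol \<eta> as bs \<and> length as = k \<and> \<gamma> = set as \<union> set bs"
    proof
      assume "U = UNIV"
      then obtain p where p: "block \<eta> p k" "\<gamma> = {p..<p + 2 * k}" using ts_step_block[OF f] U by blast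
      then show ?thesis
        by (intro exI[of _ "[p..<p + k]"] exI[of _ "[p + k..<p + 2 * k]"]) (auto simp: sol_block f)
    next
      assume "\<exists>p l V. block \<eta> p l \<and> ts_uncrossed (\<eta> \<circ> bypass p (2 * l)) V \<and> U = bypass p (2 * l) ` V"
      then obtain p l V where l: "block \<eta> p l" "ts_uncrossed (\<eta> \<circ> bypass p (2 * l)) V" "U = bypass p (2 * l) ` V"
        by blast
      obtain \<gamma>' where \<gamma>': "ts_step (\<eta> \<circ> bypass p (2 * l)) V k \<gamma>'" "\<gamma> = bypass p (2 * l) ` \<gamma>'"
        using U(2) ts_step_image[OF strict_mono_bypass bypass_0[OF block_pos(1)[OF f l(1)]]] l(3) by blast
      then have "soliton (\<eta> \<circ> bypass p (2 * l)) k \<gamma>'" using l(2) by (auto simp: soliton_def)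
      then obtain as bs where s: "sol (\<eta> \<circ> bypass p (2 * l)) as bs" "length as = k" "\<gamma>' = set as \<union> set bs"
        using IH[OF l(1)] by blast
      have "\<gamma> = set (map (bypass p (2 * l)) as) \<union> set (map (bypass p (2 * l)) bs)"
        using \<gamma>'(2) s(3) by (simp add: image_Un)
      then show ?thesis using sol_map_bypass[OF s(1) f l(1) refl] s(2) length_map by blast
    qed
  next
    assume "\<exists>as bs. sol \<eta> as bs \<and> length as = k \<and> \<gamma> = set as \<union> set bs"
    then obtain as bs where s: "sol \<eta> as bs" "length as = k" "\<gamma> = set as \<union> set bs" by blast
    have "\<exists>x. \<eta> x \<noteq> 0" using sol_invariant[OF s(1) f] by metis
    then obtain l \<delta> where l: "ts_step \<eta> UNIV l \<delta>" using ex_ts_step[OF f] by metis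
    obtain p where p: "block \<eta> p l" "\<delta> = {p..<p + 2 * l}" using ts_step_block[OF f l] by blast
    from sol_outside_block[OF s(1) f p(1)]
    show "soliton \<eta> k \<gamma>"
    proof
      assume "as = [p..<p + l] \<and> bs = [p + l..<p + 2 * l]"
      then have "k = l" "\<gamma> = \<delta>" using s p by auto
      then show ?thesis using l ts_uncrossed.init by (auto simp: soliton_def)
    next
      assume "\<exists>as' bs'. sol (\<eta> \<circ> bypass p (2 * l)) as' bs' \<and> as = map (bypass p (2 * l)) as' \<and> bs = map (bypass p (2 * l)) bs'"
      then obtain as' bs' where s': "sol (\<eta> \<circ> bypass p (2 * l)) as' bs'"
        "as = map (bypass p (2 * l)) as'" "bs = map (bypass p (2 * l)) bs'" by blast
      then have "soliton (\<eta> \<circ> bypass p (2 * l)) k (set as' \<union> set bs')" using IH[OF p(1)] s(2) by auto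
      then obtain V where V: "ts_uncrossed (\<eta> \<circ> bypass p (2 * l)) V"
        "ts_step (\<eta> \<circ> bypass p (2 * l)) V k (set as' \<union> set bs')" by (auto simp: soliton_def)
      have p0: "0 < p" using block_pos[OF f p(1)] by simp
      have "\<gamma> = bypass p (2 * l) ` (set as' \<union> set bs')" using s(3) s' by auto
      then have "ts_step \<eta> (bypass p (2 * l) ` V) k \<gamma>"
        using V(2) ts_step_image[OF strict_mono_bypass bypass_0[OF p0]] by blast
      then show ?thesis
        using ts_uncrossed_image[OF _ p0 V(1)] l p(2) by (auto simp: soliton_def)
    qed
  qed
qed

subsection \<open>Time evolution\<close>

lemma carrier_load_bounds:
  assumes "finconf \<eta>"
  shows "0 \<le> carrier_load l \<eta> x \<and> (\<forall>n. l = enat n \<longrightarrow> carrier_load l \<eta> x \<le> int n)"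
proof (induction x)
  case (Suc x)
  then show ?case
    using finconf_cases[OF assms, of "Suc x"] by (cases l) (auto simp: min_room_def)
qed simp

lemma carrier_load_nonneg: "finconf \<eta> \<Longrightarrow> 0 \<le> carrier_load l \<eta> x"
  using carrier_load_bounds by blast

lemma carrier_load_le: "finconf \<eta> \<Longrightarrow> carrier_load (enat n) \<eta> x \<le> int n"
  using carrier_load_bounds by blast

lemma min_room_enat [simp]: "min_room a (enat n) w = min a (int n - w)"
  and min_room_infinity [simp]: "min_room a \<infinity> w = a"
  by (simp_all add: min_room_def)

lemma finconf_bbs:
  assumes f: "finconf \<eta>"
  shows "finconf (bbs l \<eta>)"
proof -
  have "bbs l \<eta> x = 0 \<or> bbs l \<eta> x = 1" for x
  proof (cases x)
    case (Suc y)
    have "\<And>n. l = enat n \<Longrightarrow> carrier_load l \<eta> y \<le> int n" using carrier_load_le[OF f] by blast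
    then show ?thesis
      using Suc finconf_cases[OF f, of x] carrier_load_nonneg[OF f, of l y]
      by (cases l) (auto simp: bbs_def min_def)
  qed (simp add: bbs_def finconf_0 f)
  moreover obtain N where N: "\<forall>x\<ge>N. \<eta> x = 0" using f by (auto simp: finconf_def)
  \<comment> \<open>From \<open>N\<close> on the carrier drops one ball per site until it is empty,
    which bounds the support of the evolved configuration.\<close>
  have load: "carrier_load l \<eta> (N + t) = max 0 (carrier_load l \<eta> N - int t)" for t
  proof (induction t)
    case 0
    then show ?case using carrier_load_nonneg[OF f, of l N] by simp
  next
    case (Suc t)
    have "\<eta> (Suc (N + t)) = 0" using N by simp
    moreover have "min_room 0 l (carrier_load l \<eta> (N + t)) = 0"
      using carrier_load_le[OF f] by (cases l) simp_all
    ultimately show ?case using Suc by (simp add: max_def min_def)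
  qed
  have "bbs l \<eta> x = 0" if "Suc N + nat (carrier_load l \<eta> N) \<le> x" for x
    using N that load[of "x - 1 - N"] load[of "x - N"] by (simp add: bbs_def)
  ultimately show ?thesis using finconf_0[OF f] unfolding finconf_def by (auto simp: bbs_def)
qed

text \<open>Split the carrier into one place for the letter just read and \<open>l\<close> further
  places. A jump only exchanges the content of the single place; a repeat leaves it alone and acts
  on the others as the letter of \<open>skip \<eta>\<close> acts on a carrier of capacity
  \<open>l\<close>.\<close>

lemma carrier_load_skip:
  assumes f: "finconf \<eta>"
  shows "stay \<eta> i \<le> x \<Longrightarrow> x < stay \<eta> (Suc i) \<Longrightarrow>
    carrier_load (eSuc l) \<eta> x = \<eta> x + carrier_load l (skip \<eta>) i"
proof (induction x arbitrary: i)
  case 0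
  then have "stay \<eta> i = stay \<eta> 0" using f by simp
  then have "i = 0" using f by (metis stay_eq)
  then show ?case using finconf_0[OF f] by simp
next
  case (Suc x)
  show ?case
  proof (cases "stay \<eta> i = Suc x")
    case True
    then obtain j where j: "i = Suc j" using f by (cases i) auto
    then have "stay \<eta> j < stay \<eta> i" using f by simp
    then have "carrier_load (eSuc l) \<eta> x = \<eta> x + carrier_load l (skip \<eta>) j"
      using Suc.IH[of j] True j by simp
    moreover have "\<eta> (Suc x) = \<eta> x" "skip \<eta> (Suc j) = \<eta> x"
      using stay_stays[OF f, of i] True j by (simp_all add: skip_apply)
    moreover have "0 \<le> carrier_load l (skip \<eta>) j" "\<And>n. l = enat n \<Longrightarrow> carrier_load l (skip \<eta>) j \<le> int n"
      using carrier_load_bounds[OF finconf_skip[OF f]] by blast+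
    ultimately show ?thesis
      using j finconf_cases[OF f, of x] by (cases l) (auto simp: eSuc_enat)
  next
    case False
    then have "carrier_load (eSuc l) \<eta> x = \<eta> x + carrier_load l (skip \<eta>) i"
      using Suc by simp
    moreover have "\<eta> (Suc x) \<noteq> \<eta> x"
      using stay_between[OF f, of i "Suc x"] False Suc.prems by simp
    moreover have "0 \<le> carrier_load l (skip \<eta>) i" "\<And>n. l = enat n \<Longrightarrow> carrier_load l (skip \<eta>) i \<le> int n"
      using carrier_load_bounds[OF finconf_skip[OF f]] by blast+
    ultimately show ?thesis
      using finconf_cases[OF f, of x] finconf_cases[OF f, of "Suc x"]
      by (cases l) (auto simp: eSuc_enat)
  qed
qed

section \<open>The kept sites after one time step\<close>

text \<open>At a jump the new letter enters the single place and the previous letter is put down in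
  exchange.\<close>

lemma bbs_jump:
  assumes f: "finconf \<eta>" and j: "\<eta> x \<noteq> \<eta> (x - 1)"
  shows "bbs (eSuc l) \<eta> x = \<eta> (x - 1)"
proof -
  obtain i where i: "stay \<eta> i \<le> x" "x < stay \<eta> (Suc i)" using stay_interval[OF f] .
  have "x \<noteq> stay \<eta> i" using stay_stays[OF f, of i] j by auto
  then have "stay \<eta> i \<le> x - 1" "x - 1 < stay \<eta> (Suc i)" using i by auto
  then show ?thesis using carrier_load_skip[OF f] i by (simp add: bbs_def)
qed

lemma bbs_stay:
  assumes f: "finconf \<eta>"
  shows "bbs (eSuc l) \<eta> (stay \<eta> i) = bbs l (skip \<eta>) i"
proof (cases i)
  case 0
  then show ?thesis using f finconf_0 by (simp add: bbs_def skip_apply)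
next
  case (Suc j)
  have lt: "stay \<eta> j < stay \<eta> i" "stay \<eta> i < stay \<eta> (Suc i)" using f Suc by simp_all
  then have "carrier_load (eSuc l) \<eta> (stay \<eta> i - 1) = \<eta> (stay \<eta> i - 1) + carrier_load l (skip \<eta>) j"
    using Suc by (intro carrier_load_skip[OF f]) auto
  moreover have "carrier_load (eSuc l) \<eta> (stay \<eta> i) = \<eta> (stay \<eta> i) + carrier_load l (skip \<eta>) i"
    using lt by (intro carrier_load_skip[OF f]) auto
  ultimately show ?thesis using stay_stays[OF f, of i] Suc by (simp add: bbs_def skip_apply)
qed

(* A letter is left unchanged iff the carrier is full (letter 1) or empty (letter 0), and then it
   is still full or empty when the next letter is the same. *)
lemma bbs_unchanged_repeat:
  assumes f: "finconf \<eta>" and "\<eta> (Suc i) = \<eta> i" "bbs l \<eta> i = \<eta> i"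
  shows "bbs l \<eta> (Suc i) = \<eta> (Suc i)"
proof (cases i)
  case 0
  then show ?thesis using assms finconf_0[OF f] by (cases l) (auto simp: bbs_def)
next
  case (Suc j)
  then show ?thesis
    using assms finconf_cases[OF f, of i] carrier_load_bounds[OF f, of l j]
    by (cases l) (auto simp: bbs_def min_def split: if_splits)
qed

text \<open>After a ball is dropped there is room, and after one is picked up the carrier is not
  empty; so the opposite letter in the next site would be changed too.\<close>

lemma bbs_changed_unchanged:
  assumes f: "finconf \<eta>" and "bbs l \<eta> i \<noteq> \<eta> i" "bbs l \<eta> (Suc i) = \<eta> (Suc i)"
  shows "\<eta> (Suc i) = \<eta> i"
proof (cases i)
  case 0
  then show ?thesis using assms by (simp add: bbs_def)
next
  case (Suc j)
  have bounds: "0 \<le> carrier_load l \<eta> j" "\<And>n. l = enat n \<Longrightarrow> carrier_load l \<eta> j \<le> int n"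
    using carrier_load_bounds[OF f] by blast+
  show ?thesis
  proof (rule ccontr)
    assume "\<eta> (Suc i) \<noteq> \<eta> i"
    then consider "\<eta> i = 0" "\<eta> (Suc i) = 1" | "\<eta> i = 1" "\<eta> (Suc i) = 0"
      using finconf_cases[OF f] by metis
    then show False
      by cases (use assms(2,3) bounds Suc in \<open>cases l; auto simp: bbs_def min_def split: if_splits\<close>)+
  qed
qed

definition unchanged :: "enat \<Rightarrow> (nat \<Rightarrow> int) \<Rightarrow> nat \<Rightarrow> bool" where
  "unchanged l \<eta> i \<longleftrightarrow> bbs l \<eta> i = \<eta> i"

lemma unchanged_Suc:
  assumes "finconf \<eta>" "\<eta> (Suc i) = \<eta> i"
  shows "bbs l \<eta> (Suc i) = bbs l \<eta> i \<longleftrightarrow> unchanged l \<eta> i \<or> \<not> unchanged l \<eta> (Suc i)"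
  using assms bbs_unchanged_repeat[OF assms, of l]
    finconf_cases[OF finconf_bbs[OF assms(1)], of l] finconf_cases[OF assms(1)]
  unfolding unchanged_def by metis

text \<open>At deleted sites the output copies the letter one site to the left and so keeps
  alternating. New repeats can arise only next to the left end of a gap or at its right end, where
  the output is that of the shortened configuration.\<close>

lemma bbs_stays:
  assumes f: "finconf \<eta>" and x: "stay \<eta> i < x" "x \<le> stay \<eta> (Suc i)"
  shows "bbs (eSuc l) \<eta> x = bbs (eSuc l) \<eta> (x - 1) \<longleftrightarrow>
    x = Suc (stay \<eta> i) \<and> unchanged l (skip \<eta>) i \<or>
    x = stay \<eta> (Suc i) \<and> \<not> unchanged l (skip \<eta>) (Suc i)"
proof -
  let ?\<theta> = "bbs (eSuc l) \<eta>" and ?\<phi> = "bbs l (skip \<eta>)"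
  note ft = finconf_bbs[OF f, of "eSuc l"]
  have inner: "?\<theta> (x - 1) = \<eta> (x - 1 - 1)" "\<eta> (x - 1) \<noteq> \<eta> (x - 1 - 1)" if "x \<noteq> Suc (stay \<eta> i)"
    using stay_between[OF f, of i "x - 1"] bbs_jump[OF f] that x by auto
  have \<phi>: "?\<theta> (stay \<eta> j) = ?\<phi> j" "\<eta> (stay \<eta> j) = skip \<eta> j" for j
    using bbs_stay[OF f] by (simp_all add: skip_apply)
  consider "x < stay \<eta> (Suc i)" | "x = stay \<eta> (Suc i)" using x by linarith
  then show ?thesis
  proof cases
    case 1
    then have "?\<theta> x = \<eta> (x - 1)" using bbs_jump[OF f] stay_between[OF f] x by blast
    then show ?thesis
      using inner 1 \<phi>[of i] by (cases "x = Suc (stay \<eta> i)") (auto simp: unchanged_def)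
  next
    case 2
    show ?thesis
    proof (cases "x = Suc (stay \<eta> i)")
      case True
      then have "skip \<eta> (Suc i) = skip \<eta> i" using 2 skip_Suc_eq[OF f, of i] by simp
      moreover have "?\<theta> x = ?\<phi> (Suc i)" "?\<theta> (x - 1) = ?\<phi> i"
        using 2 \<phi>(1)[of "Suc i"] True \<phi>(1)[of i] by (metis diff_Suc_1)+
      ultimately show ?thesis
        using unchanged_Suc[OF finconf_skip[OF f], of i l] 2 True by metis
    next
      case False
      have "skip \<eta> (Suc i) = \<eta> (x - 1)" using stay_stays[OF f, of "Suc i"] 2 by (simp add: skip_apply)
      then have "?\<theta> (x - 1) \<noteq> skip \<eta> (Suc i)" using inner[OF False] by simp
      then show ?thesis
        using False 2 \<phi>[of "Suc i"] finconf_cases[OF ft] finconf_cases[OF finconf_skip[OF f]]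
        unfolding unchanged_def by metis
    qed
  qed
qed

text \<open>Each kept site yields one kept site of the evolved configuration: itself if its letter
  changed, its right neighbour otherwise. The index moves by one because site 0 is kept as well,
  while the old site 0, being unchanged, yields site 1.\<close>

lemma stay_bbs:
  assumes f: "finconf \<eta>"
  shows "stay (bbs (eSuc l) \<eta>) (Suc i) = stay \<eta> i + of_bool (unchanged l (skip \<eta>) i)"
proof -
  let ?\<theta> = "bbs (eSuc l) \<eta>" and ?u = "unchanged l (skip \<eta>)"
  define h where "h j = (case j of 0 \<Rightarrow> 0 | Suc i \<Rightarrow> stay \<eta> i + of_bool (?u i))" for j
  have u0: "?u 0" using f finconf_skip by (simp add: unchanged_def bbs_def)
  have "strict_mono h"
    unfolding strict_mono_Suc_iff
  proof
    fix j show "h j < h (Suc j)"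
    proof (cases j)
      case 0
      then show ?thesis using u0 f by (simp add: h_def)
    next
      case (Suc i)
      have lt: "stay \<eta> i < stay \<eta> (Suc i)" using f by simp
      \<comment> \<open>Moving right causes no collision: adjacent kept sites carry equal letters,
        so if the first one is unchanged, the second one is too and moves as well.\<close>
      have "?u (Suc i)" if "stay \<eta> (Suc i) = Suc (stay \<eta> i)" "?u i"
        using that skip_Suc_eq[OF f, of i] bbs_unchanged_repeat[OF finconf_skip[OF f]]
        unfolding unchanged_def by simp
      then show ?thesis using lt Suc by (auto simp: h_def intro: Suc_lessI)
    qed
  qed
  moreover have "range h = {x. ?\<theta> x = ?\<theta> (x - 1)}"
  proof (intro subset_antisym subsetI)
    fix x assume "x \<in> range h"
    then obtain j where j: "x = h j" by blast
    show "x \<in> {x. ?\<theta> x = ?\<theta> (x - 1)}"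
    proof (cases j)
      case 0
      then show ?thesis using j by (simp add: h_def)
    next
      case (Suc i)
      show ?thesis
      proof (cases "?u i")
        case True
        have "stay \<eta> i < stay \<eta> (Suc i)" using f by simp
        then show ?thesis using bbs_stays[OF f, of i x l] True j Suc by (simp add: h_def)
      next
        case False
        then obtain i' where i': "i = Suc i'" using u0 by (cases i) auto
        then have "stay \<eta> i' < stay \<eta> i" using f by simp
        then show ?thesis using bbs_stays[OF f, of i' x l] False j Suc i' by (simp add: h_def)
      qed
    qed
  next
    fix x assume x: "x \<in> {x. ?\<theta> x = ?\<theta> (x - 1)}"
    show "x \<in> range h"
    proof (cases x)
      case 0
      then show ?thesis by (intro range_eqI[of _ _ 0]) (simp add: h_def)
    next
      case (Suc y)
      obtain i where i: "stay \<eta> i \<le> y" "y < stay \<eta> (Suc i)" using stay_interval[OF f] .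
      then have "x = Suc (stay \<eta> i) \<and> ?u i \<or> x = stay \<eta> (Suc i) \<and> \<not> ?u (Suc i)"
        using bbs_stays[OF f, of i x l] x Suc by simp
      then have "x = h (Suc i) \<or> x = h (Suc (Suc i))" by (auto simp: h_def)
      then show ?thesis by blast
    qed
  qed
  ultimately have "stay ?\<theta> = h" by (intro stay_unique finconf_bbs f)
  then show ?thesis by (simp add: h_def)
qed

lemma skip_bbs_Suc:
  assumes f: "finconf \<eta>"
  shows "skip (bbs (eSuc l) \<eta>) (Suc i) = bbs l (skip \<eta>) i"
proof (cases "unchanged l (skip \<eta>) i")
  case True
  have "stay \<eta> i < stay \<eta> (Suc i)" using f by simp
  then have "bbs (eSuc l) \<eta> (Suc (stay \<eta> i)) = bbs (eSuc l) \<eta> (stay \<eta> i)"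
    using bbs_stays[OF f, of i "Suc (stay \<eta> i)" l] True by simp
  then show ?thesis using True bbs_stay[OF f] by (simp add: skip_apply stay_bbs f)
next
  case False
  then show ?thesis using bbs_stay[OF f] by (simp add: skip_apply stay_bbs f)
qed

section \<open>The additional record and the resulting shift\<close>

definition pad :: "(nat \<Rightarrow> int) \<Rightarrow> nat \<Rightarrow> int" where
  "pad \<eta> x = (case x of 0 \<Rightarrow> 0 | Suc y \<Rightarrow> \<eta> y)"

lemma skip_bbs: "finconf \<eta> \<Longrightarrow> skip (bbs (eSuc l) \<eta>) = pad (bbs l (skip \<eta>))"
  using skip_bbs_Suc finconf_0[OF finconf_skip[OF finconf_bbs]]
  by (auto simp: pad_def fun_eq_iff split: nat.splits)

lemma finconf_pad:
  assumes "finconf \<eta>"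
  shows "finconf (pad \<eta>)"
proof -
  obtain N where "\<forall>x\<ge>N. \<eta> x = 0" using assms by (auto simp: finconf_def)
  then have "\<forall>x\<ge>Suc N. pad \<eta> x = 0" by (auto simp: pad_def split: nat.splits)
  then show ?thesis using assms unfolding finconf_def by (auto simp: pad_def split: nat.splits)
qed

lemma stay_pad:
  assumes f: "finconf \<eta>"
  shows "stay (pad \<eta>) (Suc i) = Suc (stay \<eta> i)"
proof -
  define h where "h j = (case j of 0 \<Rightarrow> 0 | Suc i \<Rightarrow> Suc (stay \<eta> i))" for j
  have "strict_mono h"
    unfolding strict_mono_Suc_iff h_def using f by (auto split: nat.splits)
  moreover have "range h = {x. pad \<eta> x = pad \<eta> (x - 1)}"
  proof -
    have *: "pad \<eta> (Suc y) = pad \<eta> y \<longleftrightarrow> \<eta> y = \<eta> (y - 1)" for y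
      using finconf_0[OF f] by (auto simp: pad_def split: nat.splits)
    have "x \<in> range h \<longleftrightarrow> pad \<eta> x = pad \<eta> (x - 1)" for x
    proof (cases x)
      case 0
      then show ?thesis by (auto intro!: range_eqI[of _ _ 0] simp: h_def)
    next
      case (Suc y)
      have "x \<in> range h \<longleftrightarrow> y \<in> range (stay \<eta>)"
      proof
        assume "x \<in> range h"
        then obtain j where "x = h j" by blast
        then show "y \<in> range (stay \<eta>)" using Suc by (cases j) (auto simp: h_def)
      next
        assume "y \<in> range (stay \<eta>)"
        then obtain i where "y = stay \<eta> i" by blast
        then show "x \<in> range h" using Suc by (intro range_eqI[of _ _ "Suc i"]) (simp add: h_def)
      qed
      then show ?thesis using Suc * range_stay[OF f] by simp
    qed
    then show ?thesis by blast
  qed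
  ultimately have "stay (pad \<eta>) = h" by (intro stay_unique finconf_pad f)
  then show ?thesis by (simp add: h_def)
qed

lemma skip_pad: "finconf \<eta> \<Longrightarrow> skip (pad \<eta>) = pad (skip \<eta>)"
  by (auto simp: fun_eq_iff skip_apply pad_def stay_pad finconf_pad split: nat.splits)

(* zeta k counts (k + 1)-solitons *)
fun zeta :: "nat \<Rightarrow> (nat \<Rightarrow> int) \<Rightarrow> nat \<Rightarrow> nat" where
  "zeta 0 \<eta> i = (stay \<eta> (Suc i) - stay \<eta> i - 1) div 2"
| "zeta (Suc k) \<eta> i = zeta k (skip \<eta>) i"

lemma zeta_pad:
  "finconf \<eta> \<Longrightarrow> zeta k (pad \<eta>) i = (case i of 0 \<Rightarrow> 0 | Suc j \<Rightarrow> zeta k \<eta> j)"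
  by (induction k arbitrary: \<eta>)
    (auto simp: stay_pad finconf_pad skip_pad finconf_skip split: nat.splits)

text \<open>The distance between consecutive kept sites changes by at most one. It grows only if it
  is odd and shrinks only if it is even, and neither alters the number of complete pairs in
  between.\<close>

lemma zeta_0_bbs:
  assumes f: "finconf \<eta>"
  shows "zeta 0 (bbs (eSuc l) \<eta>) (Suc i) = zeta 0 \<eta> i"
proof -
  let ?u = "unchanged l (skip \<eta>)"
  have lt: "stay \<eta> i < stay \<eta> (Suc i)" using f by simp
  note odd = skip_Suc_eq[OF f, of i]
  have up: "odd (stay \<eta> (Suc i) - stay \<eta> i)" if "\<not> ?u i" "?u (Suc i)"
    using that bbs_changed_unchanged[OF finconf_skip[OF f]] odd unfolding unchanged_def by blast
  have down: "even (stay \<eta> (Suc i) - stay \<eta> i)" if "?u i" "\<not> ?u (Suc i)"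
    using that bbs_unchanged_repeat[OF finconf_skip[OF f]] odd unfolding unchanged_def by blast
  obtain g where g: "stay \<eta> (Suc i) = stay \<eta> i + g" "0 < g" using lt by (metis less_imp_add_positive)
  consider "?u i = ?u (Suc i)" | "\<not> ?u i" "?u (Suc i)" | "?u i" "\<not> ?u (Suc i)" by blast
  then show ?thesis
  proof cases
    case 2
    then have "odd g" using up g by simp
    then show ?thesis using 2 g by (auto simp: stay_bbs f elim!: oddE)
  next
    case 3
    then have "even g" using down g by simp
    then obtain b where "g = 2 * Suc b" using g(2) by (metis evenE gr0_implies_Suc mult_0_right not_gr0)
    then show ?thesis using 3 g by (simp add: stay_bbs f)
  qed (simp add: stay_bbs f)
qed

lemma bbs_0: "finconf \<eta> \<Longrightarrow> bbs 0 \<eta> = \<eta>"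
proof -
  assume f: "finconf \<eta>"
  have "carrier_load 0 \<eta> x = 0" for x
    using carrier_load_bounds[OF f, of 0 x] zero_enat_def by fastforce
  then show ?thesis by (simp add: bbs_def fun_eq_iff)
qed

lemma enat_nonzeroE:
  assumes "l \<noteq> 0"
  obtains l' where "l = eSuc l'"
proof (cases l)
  case (enat n)
  then obtain m where "n = Suc m" using assms by (cases n) (auto simp: zero_enat_def)
  then show ?thesis using that[of "enat m"] enat by (simp add: eSuc_enat)
next
  case infinity
  then show ?thesis using that[of \<infinity>] by simp
qed

lemma the_enat_0: "the_enat 0 = 0"
  by (simp add: zero_enat_def)

text \<open>Each level uses one unit of capacity and gains one \<open>pad\<close>, that is, a shift
  by one. The recursion ends at level 0 with a last shift, or at capacity 0, where nothing
  moves.\<close>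

lemma zeta_bbs:
  "finconf \<eta> \<Longrightarrow> zeta k (bbs l \<eta>) i =
     (let a = the_enat (min (enat (Suc k)) l) in if i < a then 0 else zeta k \<eta> (i - a))"
proof (induction k arbitrary: \<eta> l i)
  case 0
  note f = \<open>finconf \<eta>\<close>
  show ?case
  proof (cases "l = 0")
    case True
    then show ?thesis by (simp add: bbs_0 f Let_def the_enat_0)
  next
    case False
    then obtain l' where l: "l = eSuc l'" using enat_nonzeroE by blast
    have "min (enat (Suc 0)) l = enat 1" unfolding l by (cases l') (auto simp: eSuc_enat min_def)
    \<comment> \<open>The first two kept sites of the evolved configuration are 0 and 1, with
      nothing between them.\<close>
    moreover have "zeta 0 (bbs l \<eta>) 0 = 0"
      using stay_bbs[OF f, of l' 0] f finconf_bbs[OF f] unfolding l by simp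
    moreover have "zeta 0 (bbs l \<eta>) (Suc j) = zeta 0 \<eta> j" for j unfolding l by (rule zeta_0_bbs[OF f])
    ultimately show ?thesis by (cases i) (simp_all del: zeta.simps)
  qed
next
  case (Suc k)
  note f = \<open>finconf \<eta>\<close>
  show ?case
  proof (cases "l = 0")
    case True
    then show ?thesis by (simp add: bbs_0 f Let_def the_enat_0)
  next
    case False
    then obtain l' where l: "l = eSuc l'" using enat_nonzeroE by blast
    have "min (enat (Suc (Suc k))) l = eSuc (min (enat (Suc k)) l')"
      unfolding l by (simp add: eSuc_enat[symmetric] min_def)
    then have a: "the_enat (min (enat (Suc (Suc k))) l) = Suc (the_enat (min (enat (Suc k)) l'))"
      by (cases l') (auto simp: eSuc_enat min_def)
    have "zeta (Suc k) (bbs l \<eta>) i = (case i of 0 \<Rightarrow> 0 | Suc j \<Rightarrow> zeta k (bbs l' (skip \<eta>)) j)"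
      unfolding l by (simp add: skip_bbs f zeta_pad finconf_bbs finconf_skip)
    then show ?thesis
      unfolding a using Suc.IH[OF finconf_skip[OF f], of l'] by (cases i) (simp_all add: Let_def)
  qed
qed

subsection \<open>Slot configuration and slot decomposition\<close>

lemma sol_skipE:
  assumes "sol \<eta> as bs" "length as \<noteq> 1" "finconf \<eta>"
  obtains as' bs' where "sol (skip \<eta>) as' bs'" "as' \<noteq> []" "length bs' = length as'"
    "as = (stay \<eta> (hd as') - 1) # map (stay \<eta>) as'" "bs = (stay \<eta> (hd bs') - 1) # map (stay \<eta>) bs'"
  using assms(1)
proof (cases rule: sol.cases)
  case (lift as' bs')
  then show ?thesis using that sol_invariant[OF lift(3) finconf_skip[OF assms(3)]] by blast
qed (use assms(2) in simp)

lemma sol_length_1: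
  assumes "sol \<eta> as bs" "length as = 1" "finconf \<eta>"
  obtains x where "as = [x]" "bs = [Suc x]" "odd_jump \<eta> x" "\<eta> (Suc x) \<noteq> \<eta> x"
  using assms(1)
proof (cases rule: sol.cases)
  case (lift as' bs')
  then have "as' \<noteq> []" using sol_invariant[OF lift(3) finconf_skip[OF assms(3)]] by simp
  then show ?thesis using lift assms(2) by simp
qed (use that in blast)

lemma sol_sorted_list_of_set:
  assumes "sol \<eta> as bs" "finconf \<eta>"
  shows "sorted_list_of_set (set as \<union> set bs) = as @ bs"
proof -
  have "sorted_wrt (<) (as @ bs)" using sol_invariant[OF assms] by blast
  then have "sorted (as @ bs)" "distinct (as @ bs)" using strict_sorted_iff by blast+
  then have "sorted_list_of_set (set (as @ bs)) = as @ bs"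
    by (rule sorted_list_of_set.idem_if_sorted_distinct)
  then show ?thesis by simp
qed

text \<open>Sorting the union recovers \<open>as @ bs\<close>, and the common length tells where to
  divide it.\<close>

lemma sol_unique:
  assumes "sol \<eta> as bs" "sol \<eta> as' bs'" "finconf \<eta>" "length as = length as'"
    "set as \<union> set bs = set as' \<union> set bs'"
  shows "as = as' \<and> bs = bs'"
  using assms sol_sorted_list_of_set by (metis append_eq_append_conv)

text \<open>Relational form of the slot number, for which existence and uniqueness are proved before
  the definite description in \<open>slot_config\<close> is evaluated. The index \<open>v\<close>
  counts from 0 and corresponds to \<open>l - 1\<close>.\<close>

definition slot_value :: "(nat \<Rightarrow> int) \<Rightarrow> nat \<Rightarrow> nat \<Rightarrow> bool" where
  "slot_value \<eta> x v \<longleftrightarrow> (\<exists>as bs. sol \<eta> as bs \<and> v < length as \<and> (x = as ! v \<or> x = bs ! v))"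

lemma slot_value_iff:
  assumes f: "finconf \<eta>"
  shows "(\<exists>k \<gamma> l. soliton \<eta> k \<gamma> \<and> 1 \<le> l \<and> l \<le> k
      \<and> (x = component \<gamma> l \<or> x = component \<gamma> (l + k)) \<and> v = l - 1) \<longleftrightarrow> slot_value \<eta> x v"
proof -
  have comp: "component (set as \<union> set bs) (Suc v) = as ! v"
    "component (set as \<union> set bs) (Suc v + length as) = bs ! v"
    if "sol \<eta> as bs" "v < length as" for as bs v
    unfolding component_def sol_sorted_list_of_set[OF that(1) f] using that(2) by (simp_all add: nth_append)
  show ?thesis
  proof
    assume "\<exists>k \<gamma> l. soliton \<eta> k \<gamma> \<and> 1 \<le> l \<and> l \<le> k
      \<and> (x = component \<gamma> l \<or> x = component \<gamma> (l + k)) \<and> v = l - 1"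
    then obtain k \<gamma> l where h: "soliton \<eta> k \<gamma>" "1 \<le> l" "l \<le> k" "v = l - 1"
      "x = component \<gamma> l \<or> x = component \<gamma> (l + k)" by blast
    obtain as bs where s: "sol \<eta> as bs" "length as = k" "\<gamma> = set as \<union> set bs"
      using h(1) unfolding soliton_iff[OF f] by blast
    have "l = Suc v" "v < length as" using h s(2) by auto
    then have "x = as ! v \<or> x = bs ! v" using comp[OF s(1)] h(5) unfolding s(3) s(2)[symmetric] by metis
    then show "slot_value \<eta> x v" using s(1) \<open>v < length as\<close> unfolding slot_value_def by blast
  next
    assume "slot_value \<eta> x v"
    then obtain as bs where s: "sol \<eta> as bs" "v < length as" "x = as ! v \<or> x = bs ! v"
      unfolding slot_value_def by blast
    then have "soliton \<eta> (length as) (set as \<union> set bs)" using soliton_iff[OF f] by blast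
    moreover have "x = component (set as \<union> set bs) (Suc v) \<or> x = component (set as \<union> set bs) (Suc v + length as)"
      using comp s by metis
    ultimately show "\<exists>k \<gamma> l. soliton \<eta> k \<gamma> \<and> 1 \<le> l \<and> l \<le> k
      \<and> (x = component \<gamma> l \<or> x = component \<gamma> (l + k)) \<and> v = l - 1"
      using s(2) by (intro exI[of _ "length as"] exI[of _ "set as \<union> set bs"] exI[of _ "Suc v"]) auto
  qed
qed

lemma slot_config_value:
  "finconf \<eta> \<Longrightarrow> slot_config \<eta> x = (if is_record \<eta> x then \<infinity> else enat (THE v. slot_value \<eta> x v))"
  unfolding slot_config_def by (simp only: slot_value_iff)

lemma slot_value_0_jump:
  assumes "slot_value \<eta> x 0" and f: "finconf \<eta>"
  shows "\<eta> x \<noteq> \<eta> (x - 1)"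
proof -
  obtain as bs where s: "sol \<eta> as bs" "x = as ! 0 \<or> x = bs ! 0"
    using assms unfolding slot_value_def by blast
  have inv: "as \<noteq> []" "length bs = length as" "\<eta> (hd as) \<noteq> \<eta> (hd as - 1)" "\<eta> (hd bs) \<noteq> \<eta> (hd bs - 1)"
    using sol_invariant[OF s(1) f] by blast+
  then have "bs \<noteq> []" by auto
  then show ?thesis using s(2) inv by (metis hd_conv_nth)
qed

text \<open>Lifting puts the inserted sites at index 0 of both halves and moves all other entries up
  by one.\<close>

lemma slot_value_Suc:
  assumes "finconf \<eta>"
  shows "slot_value \<eta> x (Suc v) \<longleftrightarrow> (\<exists>y. x = stay \<eta> y \<and> slot_value (skip \<eta>) y v)"
proof
  assume "slot_value \<eta> x (Suc v)"
  then obtain as bs where s: "sol \<eta> as bs" "Suc v < length as" "x = as ! Suc v \<or> x = bs ! Suc v"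
    unfolding slot_value_def by blast
  then obtain as' bs' where s': "sol (skip \<eta>) as' bs'" "length bs' = length as'"
    "as = (stay \<eta> (hd as') - 1) # map (stay \<eta>) as'" "bs = (stay \<eta> (hd bs') - 1) # map (stay \<eta>) bs'"
    using sol_skipE[OF s(1) _ assms] by (metis One_nat_def less_SucE not_less0 Suc_less_eq)
  then show "\<exists>y. x = stay \<eta> y \<and> slot_value (skip \<eta>) y v"
    using s unfolding slot_value_def by auto
next
  assume "\<exists>y. x = stay \<eta> y \<and> slot_value (skip \<eta>) y v"
  then obtain y as bs where s: "x = stay \<eta> y" "sol (skip \<eta>) as bs" "v < length as" "y = as ! v \<or> y = bs ! v"
    unfolding slot_value_def by blast
  moreover have "length bs = length as" using sol_invariant[OF s(2) finconf_skip[OF assms]] by blast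
  ultimately show "slot_value \<eta> x (Suc v)"
    unfolding slot_value_def using sol.lift[OF s(2)] by fastforce
qed

lemma slot_value_jump_unique:
  "finconf \<eta> \<Longrightarrow> \<eta> x \<noteq> \<eta> (x - 1) \<Longrightarrow> slot_value \<eta> x v \<Longrightarrow> v = 0"
  using slot_value_Suc stay_stays by (metis not0_implies_Suc)

text \<open>A jump at even offset in its gap is paired with the site before it, one at odd offset
  with the next site if that is a jump. In the remaining case the next site is kept and starts a run
  of \<open>skip \<eta>\<close>; recursively it heads a half of a soliton, and lifting inserts
  \<open>x\<close> before it.\<close>

lemma slot_value_jump:
  "finconf \<eta> \<Longrightarrow> \<eta> x \<noteq> \<eta> (x - 1) \<Longrightarrow> slot_value \<eta> x 0"
proof (induction "ones \<eta>" arbitrary: \<eta> x rule: less_induct)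
  case less
  note f = \<open>finconf \<eta>\<close> and j = \<open>\<eta> x \<noteq> \<eta> (x - 1)\<close>
  obtain i where i: "stay \<eta> i \<le> x" "x < stay \<eta> (Suc i)" using stay_interval[OF f] .
  then obtain t where t: "x = stay \<eta> i + t" by (metis le_iff_add)
  have t0: "0 < t" using t j stay_stays[OF f, of i] by (cases t) auto
  have gap: "odd_jump \<eta> x = odd t" "(\<eta> x = \<eta> (stay \<eta> i)) = even t"
    using gap_alternates[OF f, of i t] i t by auto
  have unit: "slot_value \<eta> y 0 \<and> slot_value \<eta> (Suc y) 0" if "odd_jump \<eta> y" "\<eta> (Suc y) \<noteq> \<eta> y" for y
    using sol.unit[OF that] unfolding slot_value_def by fastforce
  show ?case
  proof (cases "odd t")
    case False
    then have "odd_jump \<eta> (x - 1)" using gap_alternates[OF f, of i "t - 1"] i t t0 by simp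
    then show ?thesis using unit[of "x - 1"] j t t0 by simp
  next
    case odd: True
    show ?thesis
    proof (cases "\<eta> (Suc x) = \<eta> x")
      case False
      then show ?thesis using unit gap odd by blast
    next
      case True
      have s: "stay \<eta> (Suc i) = Suc x"
        using stay_between[OF f, of i "Suc x"] True i by (metis Suc_lessI diff_Suc_1 less_SucI le_imp_less_Suc)
      have "skip \<eta> (Suc i) \<noteq> skip \<eta> (Suc i - 1)"
        using s True gap odd by (simp add: skip_apply)
      moreover have "\<exists>z. \<eta> z \<noteq> 0" using j by metis
      ultimately have "slot_value (skip \<eta>) (Suc i) 0"
        using less.hyps ones_skip[OF f] finconf_skip[OF f] by blast
      then obtain as bs where ab: "sol (skip \<eta>) as bs" "0 < length as" "Suc i = as ! 0 \<or> Suc i = bs ! 0"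
        unfolding slot_value_def by blast
      then have "Suc i = hd as \<or> Suc i = hd bs"
        using sol_invariant[OF ab(1) finconf_skip[OF f]] by (metis hd_conv_nth length_0_conv)
      then have "x = stay \<eta> (hd as) - 1 \<or> x = stay \<eta> (hd bs) - 1" using s by auto
      then show ?thesis
        using sol.lift[OF ab(1)] unfolding slot_value_def by (metis length_greater_0_conv list.distinct(1) nth_Cons_0)
    qed
  qed
qed

lemma carrier_load_infinity:
  "finconf \<eta> \<Longrightarrow> stay \<eta> i \<le> x \<Longrightarrow> x < stay \<eta> (Suc i) \<Longrightarrow>
    carrier_load \<infinity> \<eta> x = \<eta> x + carrier_load \<infinity> (skip \<eta>) i"
  using carrier_load_skip[of \<eta> i x \<infinity>] by simp

text \<open>The load of the unbounded carrier is the current letter plus a nonnegative number, so an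
  empty carrier forces the letter 0 on both sides of a record.\<close>

lemma not_record_jump:
  assumes f: "finconf \<eta>" and j: "\<eta> x \<noteq> \<eta> (x - 1)"
  shows "\<not> is_record \<eta> x"
proof
  assume r: "is_record \<eta> x"
  have "\<eta> y = 0" if y: "carrier_load \<infinity> \<eta> y = 0" for y
  proof -
    obtain i where i: "stay \<eta> i \<le> y" "y < stay \<eta> (Suc i)" using stay_interval[OF f] .
    then have "\<eta> y + carrier_load \<infinity> (skip \<eta>) i = 0" using carrier_load_infinity[OF f i] y by simp
    then show ?thesis
      using finconf_cases[OF f, of y] carrier_load_nonneg[OF finconf_skip[OF f], of \<infinity> i] by linarith
  qed
  then show False using r j unfolding is_record_def by metis
qed

lemma is_record_stay:
  assumes f: "finconf \<eta>" and "0 < y"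
  shows "is_record \<eta> (stay \<eta> y) \<longleftrightarrow> is_record (skip \<eta>) y"
proof -
  obtain z where z: "y = Suc z" using assms(2) by (cases y) auto
  have lt: "stay \<eta> z < stay \<eta> y" "stay \<eta> y < stay \<eta> (Suc y)" using f z by simp_all
  let ?W = "carrier_load \<infinity> (skip \<eta>)"
  have "carrier_load \<infinity> \<eta> (stay \<eta> y) = skip \<eta> y + ?W y"
    using carrier_load_infinity[OF f, of y "stay \<eta> y"] lt by (simp add: skip_apply)
  moreover have "carrier_load \<infinity> \<eta> (stay \<eta> y - 1) = skip \<eta> y + ?W z"
    using carrier_load_infinity[OF f, of z "stay \<eta> y - 1"] lt z stay_stays[OF f, of y] by (simp add: skip_apply)
  moreover have "0 \<le> ?W z" "0 \<le> ?W y" using carrier_load_nonneg[OF finconf_skip[OF f]] by blast+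
  moreover have "?W y = ?W z + skip \<eta> y - min (1 - skip \<eta> y) (?W z)" using z by simp
  moreover have "0 < stay \<eta> y" using stay_pos f assms(2) by blast
  ultimately show ?thesis
    using finconf_cases[OF finconf_skip[OF f], of y] assms(2) z unfolding is_record_def by auto
qed

lemma slot_value_unique:
  "finconf \<eta> \<Longrightarrow> 0 < x \<Longrightarrow> \<not> is_record \<eta> x \<Longrightarrow> \<exists>!v. slot_value \<eta> x v"
proof (induction "ones \<eta>" arbitrary: \<eta> x rule: less_induct)
  case less
  note f = \<open>finconf \<eta>\<close>
  show ?case
  proof (cases "\<eta> x = \<eta> (x - 1)")
    case False
    then show ?thesis using slot_value_jump[OF f] slot_value_jump_unique[OF f] by metis
  next
    case True
    then obtain y where y: "x = stay \<eta> y" using f stay_obtain by metis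
    then have y0: "0 < y" using less.prems by (cases y) auto
    \<comment> \<open>Without ones the carrier is always empty and \<open>x\<close> would be a
      record; a one is needed for \<open>ones\<close> to decrease.\<close>
    have "\<exists>z. \<eta> z \<noteq> 0"
    proof (rule ccontr)
      assume "\<not> (\<exists>z. \<eta> z \<noteq> 0)"
      then have "\<eta> z = 0" for z by blast
      then have "carrier_load \<infinity> \<eta> z = 0" for z by (induction z) simp_all
      then show False using less.prems by (simp add: is_record_def)
    qed
    then have "\<exists>!v. slot_value (skip \<eta>) y v"
      using less.hyps ones_skip[OF f] finconf_skip[OF f] y0 is_record_stay[OF f y0] y less.prems(3) by blast
    then obtain v where v: "slot_value (skip \<eta>) y v" "\<And>w. slot_value (skip \<eta>) y w \<Longrightarrow> w = v" by blast
    show ?thesis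
    proof (rule ex1I)
      show "slot_value \<eta> x (Suc v)" using slot_value_Suc[OF f] v y by blast
      fix w assume w: "slot_value \<eta> x w"
      then obtain w' where w': "w = Suc w'" using slot_value_0_jump[OF _ f] True by (cases w) auto
      then obtain y' where "x = stay \<eta> y'" "slot_value (skip \<eta>) y' w'" using slot_value_Suc[OF f] w by blast
      then show "w = Suc v" using v y w' f by simp
    qed
  qed
qed

lemma slot_config_jump:
  assumes f: "finconf \<eta>" and "\<eta> x \<noteq> \<eta> (x - 1)"
  shows "slot_config \<eta> x = 0"
proof -
  have "(THE v. slot_value \<eta> x v) = 0"
    using slot_value_jump[OF assms] slot_value_jump_unique[OF assms] by (rule the_equality)
  then show ?thesis using not_record_jump[OF assms] by (simp add: slot_config_value f zero_enat_def)
qed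

lemma slot_config_stay:
  assumes f: "finconf \<eta>" and y: "0 < y"
  shows "slot_config \<eta> (stay \<eta> y) = eSuc (slot_config (skip \<eta>) y)"
proof (cases "is_record (skip \<eta>) y")
  case True
  then show ?thesis using is_record_stay[OF assms] by (simp add: slot_config_value f finconf_skip)
next
  case False
  then obtain v where v: "slot_value (skip \<eta>) y v" "\<And>w. slot_value (skip \<eta>) y w \<Longrightarrow> w = v"
    using slot_value_unique[OF finconf_skip[OF f] y] by blast
  have nr: "\<not> is_record \<eta> (stay \<eta> y)" using False is_record_stay[OF assms] by simp
  have "slot_value \<eta> (stay \<eta> y) (Suc v)" using slot_value_Suc[OF f] v by blast
  then have "(THE v. slot_value \<eta> (stay \<eta> y) v) = Suc v"
    using slot_value_unique[OF f stay_pos[OF f y] nr] by (metis the1_equality)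
  moreover have "(THE v. slot_value (skip \<eta>) y v) = v" using v by (rule the_equality)
  ultimately show ?thesis using False nr by (simp add: slot_config_value f finconf_skip eSuc_enat)
qed

section \<open>Slot counts and slot positions\<close>

lemma slot_count_0: "slot_count \<eta> 0 x = x"
  by (simp add: slot_count_def flip: zero_enat_def)

lemma slot_count_step:
  "slot_count \<eta> k (Suc x) = slot_count \<eta> k x + of_bool (enat k \<le> slot_config \<eta> (Suc x))"
  by (simp add: slot_count_def)

text \<open>Deleted sites have slot number 0 and never count at level \<open>Suc k\<close>, while
  kept sites have the slot number of the shortened configuration raised by one.\<close>

lemma slot_count_skip:
  assumes f: "finconf \<eta>"
  shows "stay \<eta> i \<le> x \<Longrightarrow> x < stay \<eta> (Suc i) \<Longrightarrow>
    slot_count \<eta> (Suc k) x = slot_count (skip \<eta>) k i"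
proof (induction x arbitrary: i)
  case 0
  then have "stay \<eta> i = stay \<eta> 0" using f by simp
  then have "i = 0" using f by (metis stay_eq)
  then show ?case by (simp add: slot_count_def)
next
  case (Suc x)
  show ?case
  proof (cases "stay \<eta> i = Suc x")
    case True
    then obtain j where j: "i = Suc j" using f by (cases i) auto
    then have "stay \<eta> j < stay \<eta> i" using f by simp
    then have "slot_count \<eta> (Suc k) x = slot_count (skip \<eta>) k j"
      using Suc.IH[of j] True j by simp
    moreover have "slot_config \<eta> (Suc x) = eSuc (slot_config (skip \<eta>) i)"
      using slot_config_stay[OF f, of i] True j by simp
    moreover have "enat (Suc k) \<le> eSuc c \<longleftrightarrow> enat k \<le> c" for c
      by (simp flip: eSuc_enat)
    ultimately show ?thesis using j by (simp add: slot_count_step)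
  next
    case False
    then have "slot_count \<eta> (Suc k) x = slot_count (skip \<eta>) k i" using Suc by simp
    moreover have "slot_config \<eta> (Suc x) = 0"
      using stay_between[OF f, of i "Suc x"] False Suc.prems by (intro slot_config_jump f) simp
    ultimately show ?thesis by (simp add: slot_count_step zero_enat_def)
  qed
qed

lemma slot_count_stay: "finconf \<eta> \<Longrightarrow> slot_count \<eta> (Suc k) (stay \<eta> i) = slot_count (skip \<eta>) k i"
  by (intro slot_count_skip) simp_all

lemma slot_pos_0: "slot_pos \<eta> 0 i = i"
  unfolding slot_pos_def slot_count_0 by (rule Least_equality) simp_all

text \<open>Shows that the count attains every value, so that the \<open>LEAST\<close> in
  \<open>slot_pos\<close> is meaningful.\<close>

lemma slot_count_pos: "finconf \<eta> \<Longrightarrow> slot_count \<eta> k (slot_pos \<eta> k i) = i"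
proof (induction k arbitrary: \<eta>)
  case 0
  then show ?case by (simp add: slot_count_0 slot_pos_0)
next
  case (Suc k)
  then have "slot_count \<eta> (Suc k) (stay \<eta> (slot_pos (skip \<eta>) k i)) = i"
    using slot_count_stay finconf_skip by simp
  then show ?case unfolding slot_pos_def by (rule LeastI)
qed

lemma slot_pos_Suc:
  assumes f: "finconf \<eta>"
  shows "slot_pos \<eta> (Suc k) i = stay \<eta> (slot_pos (skip \<eta>) k i)"
  unfolding slot_pos_def[of \<eta> "Suc k"]
proof (rule Least_equality)
  show "slot_count \<eta> (Suc k) (stay \<eta> (slot_pos (skip \<eta>) k i)) = i"
    using slot_count_stay slot_count_pos finconf_skip f by simp
  fix x assume x: "slot_count \<eta> (Suc k) x = i"
  obtain j where j: "stay \<eta> j \<le> x" "x < stay \<eta> (Suc j)" using stay_interval[OF f] .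
  then have "slot_count (skip \<eta>) k j = i" using slot_count_skip[OF f] x by simp
  then have "slot_pos (skip \<eta>) k i \<le> j" unfolding slot_pos_def by (rule Least_le)
  then show "stay \<eta> (slot_pos (skip \<eta>) k i) \<le> x" using j f by (meson order_trans stay_le)
qed

section \<open>Counting solitons between consecutive slots\<close>

text \<open>With pairs of lists instead of sets, lifting becomes an explicit injective map, along
  which cardinalities can be compared.\<close>

definition sols_within :: "(nat \<Rightarrow> int) \<Rightarrow> nat \<Rightarrow> nat \<Rightarrow> nat \<Rightarrow> (nat list \<times> nat list) set" where
  "sols_within \<eta> k a b = {(as, bs). sol \<eta> as bs \<and> length as = k \<and> set as \<union> set bs \<subseteq> {a..<b}}"

lemma slot_decomp_sols:
  assumes f: "finconf \<eta>"
  shows "slot_decomp \<eta> k (int i) = card (sols_within \<eta> k (slot_pos \<eta> k i) (slot_pos \<eta> k (Suc i)))"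
proof -
  let ?g = "\<lambda>(as, bs). set as \<union> set bs"
  have "{\<gamma>. soliton \<eta> k \<gamma> \<and> \<gamma> \<subseteq> {slot_pos \<eta> k i..<slot_pos \<eta> k (Suc i)}} =
      ?g ` sols_within \<eta> k (slot_pos \<eta> k i) (slot_pos \<eta> k (Suc i))"
    unfolding sols_within_def soliton_iff[OF f] by auto
  moreover have "inj_on ?g (sols_within \<eta> k a b)" for a b
    unfolding inj_on_def sols_within_def using sol_unique[OF _ _ f] by fastforce
  ultimately show ?thesis by (simp add: slot_decomp_def card_image)
qed

lemma card_sols_within_1:
  assumes f: "finconf \<eta>"
  shows "card (sols_within \<eta> 1 (stay \<eta> i) (stay \<eta> (Suc i))) = (stay \<eta> (Suc i) - stay \<eta> i - 1) div 2"
proof -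
  define e where "e = stay \<eta> i"
  obtain g where g: "stay \<eta> (Suc i) = e + Suc g"
    using f unfolding e_def by (metis lessI less_iff_Suc_add add_Suc_right stay_less)
  have gap: "odd_jump \<eta> (e + t) = odd t" "(\<eta> (e + t) = \<eta> e) = even t" if "t \<le> g" for t
    using gap_alternates[OF f, of i t] that g by (auto simp: e_def)
  \<comment> \<open>The odd jumps sit at the odd offsets, so the 1-solitons occupy the offsets
    \<open>2 * t + 1\<close> and \<open>2 * t + 2\<close>, of which the gap contains those up to
    \<open>g\<close>.\<close>
  let ?h = "\<lambda>t. ([e + 2 * t + 1], [Suc (e + 2 * t + 1)])"
  have "sols_within \<eta> 1 e (e + Suc g) = ?h ` {..<g div 2}"
  proof (intro subset_antisym subsetI)
    fix p assume "p \<in> sols_within \<eta> 1 e (e + Suc g)"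
    then obtain as bs where p: "p = (as, bs)" "sol \<eta> as bs" "length as = 1" "set as \<union> set bs \<subseteq> {e..<e + Suc g}"
      unfolding sols_within_def by blast
    obtain x where x: "as = [x]" "bs = [Suc x]" "odd_jump \<eta> x" using sol_length_1[OF p(2,3) f] by metis
    then have "e \<le> x" "Suc x < e + Suc g" using p(4) by auto
    then obtain t where t: "x = e + t" "t < g" by (auto simp: le_iff_add)
    then have "odd t" using gap(1)[of t] x(3) by simp
    then obtain s where "t = 2 * s + 1" by (rule oddE)
    then show "p \<in> ?h ` {..<g div 2}" using t p x by auto
  next
    fix p assume "p \<in> ?h ` {..<g div 2}"
    then obtain t where t: "t < g div 2" "p = ?h t" by blast
    have le: "2 * t + 2 \<le> g" using t(1) by linarith
    then have "odd_jump \<eta> (e + 2 * t + 1)" using gap(1)[of "2 * t + 1"] by simp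
    moreover have "\<eta> (Suc (e + 2 * t + 1)) \<noteq> \<eta> (e + 2 * t + 1)"
      using gap(2)[of "2 * t + 1"] gap(2)[of "2 * t + 2"] le by simp
    ultimately show "p \<in> sols_within \<eta> 1 e (e + Suc g)"
      using sol.unit t by (auto simp: sols_within_def)
  qed
  moreover have "inj_on ?h {..<g div 2}" by (auto simp: inj_on_def)
  ultimately show ?thesis using g by (simp add: e_def[symmetric] card_image)
qed

text \<open>The site inserted before the image of a head would leave the interval if that head were
  \<open>a\<close>. Heads are jumps of \<open>skip \<eta>\<close> while \<open>a\<close> is a
  repeat, so this does not occur.\<close>

lemma card_sols_within_Suc:
  assumes f: "finconf \<eta>" and a: "skip \<eta> a = skip \<eta> (a - 1)"
  shows "card (sols_within \<eta> (Suc (Suc k)) (stay \<eta> a) (stay \<eta> b)) = card (sols_within (skip \<eta>) (Suc k) a b)"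
proof -
  define h where "h = (\<lambda>(as, bs). ((stay \<eta> (hd as) - 1) # map (stay \<eta>) as, (stay \<eta> (hd bs) - 1) # map (stay \<eta>) bs))"
  have "sols_within \<eta> (Suc (Suc k)) (stay \<eta> a) (stay \<eta> b) = h ` sols_within (skip \<eta>) (Suc k) a b"
  proof (intro subset_antisym subsetI)
    fix p assume "p \<in> sols_within \<eta> (Suc (Suc k)) (stay \<eta> a) (stay \<eta> b)"
    then obtain as bs where p: "p = (as, bs)" "sol \<eta> as bs" "length as = Suc (Suc k)"
      "set as \<union> set bs \<subseteq> {stay \<eta> a..<stay \<eta> b}"
      unfolding sols_within_def by blast
    have "length as \<noteq> 1" using p(3) by simp
    then obtain as' bs' where s: "sol (skip \<eta>) as' bs'"
      "as = (stay \<eta> (hd as') - 1) # map (stay \<eta>) as'" "bs = (stay \<eta> (hd bs') - 1) # map (stay \<eta>) bs'"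
      using sol_skipE[OF p(2) _ f] by metis
    have "a \<le> y \<and> y < b" if "y \<in> set as' \<union> set bs'" for y
    proof -
      have "stay \<eta> y \<in> {stay \<eta> a..<stay \<eta> b}" using that s p(4) by auto
      then show ?thesis using f by simp
    qed
    then have "(as', bs') \<in> sols_within (skip \<eta>) (Suc k) a b"
      using s p(3) by (auto simp: sols_within_def)
    then show "p \<in> h ` sols_within (skip \<eta>) (Suc k) a b"
      using p(1) s by (intro image_eqI[of _ _ "(as', bs')"]) (simp_all add: h_def)
  next
    fix p assume "p \<in> h ` sols_within (skip \<eta>) (Suc k) a b"
    then obtain as bs where s: "p = h (as, bs)" "sol (skip \<eta>) as bs" "length as = Suc k"
      "set as \<union> set bs \<subseteq> {a..<b}" unfolding sols_within_def by blast
    have inv: "as \<noteq> []" "bs \<noteq> []" "skip \<eta> (hd as) \<noteq> skip \<eta> (hd as - 1)" "skip \<eta> (hd bs) \<noteq> skip \<eta> (hd bs - 1)"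
      using sol_invariant[OF s(2) finconf_skip[OF f]] by auto
    have mem: "stay \<eta> y \<in> {stay \<eta> a..<stay \<eta> b}" if "y \<in> set as \<union> set bs" for y
      using that s(4) f by auto
    have pred: "stay \<eta> y - 1 \<in> {stay \<eta> a..<stay \<eta> b}" if "y \<in> set as \<union> set bs" "skip \<eta> y \<noteq> skip \<eta> (y - 1)" for y
    proof -
      have "a < y" using that a s(4) by (metis atLeastLessThan_iff le_neq_implies_less subsetD)
      then have "stay \<eta> a < stay \<eta> y" using f by simp
      then show ?thesis using mem[OF that(1)] by auto
    qed
    have "hd as \<in> set as \<union> set bs" "hd bs \<in> set as \<union> set bs" using inv by simp_all
    then show "p \<in> sols_within \<eta> (Suc (Suc k)) (stay \<eta> a) (stay \<eta> b)"
      using s(1,3) sol.lift[OF s(2)] pred inv mem by (auto simp: sols_within_def h_def)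
  qed
  moreover have "inj_on h (sols_within (skip \<eta>) (Suc k) a b)"
    using inj_map_eq_map[OF strict_mono_imp_inj_on[OF strict_mono_stay[OF f]]]
    by (intro inj_onI) (auto simp: h_def)
  ultimately show ?thesis by (simp add: card_image)
qed

lemma slot_decomp_zeta: "finconf \<eta> \<Longrightarrow> slot_decomp \<eta> (Suc k) (int i) = zeta k \<eta> i"
proof (induction k arbitrary: \<eta>)
  case 0
  then show ?case
    using card_sols_within_1 by (simp add: slot_decomp_sols slot_pos_Suc slot_pos_0)
next
  case (Suc k)
  \<comment> \<open>The left end of the interval is itself a kept site of
    \<open>skip \<eta>\<close>, which supplies the repeat demanded by
    \<open>card_sols_within_Suc\<close>.\<close>
  have "skip \<eta> (slot_pos (skip \<eta>) (Suc k) i) = skip \<eta> (slot_pos (skip \<eta>) (Suc k) i - 1)"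
    using slot_pos_Suc[OF finconf_skip] stay_stays[OF finconf_skip] Suc.prems by simp
  then have "slot_decomp \<eta> (Suc (Suc k)) (int i) = slot_decomp (skip \<eta>) (Suc k) (int i)"
    using Suc.prems
    by (simp add: slot_decomp_sols finconf_skip card_sols_within_Suc slot_pos_Suc[of \<eta>])
  then show ?case using Suc finconf_skip by simp
qed

lemma finconf_Omega_fin:
  assumes "\<eta> \<in> Omega_fin"
  shows "finconf \<eta>"
proof -
  have v: "\<eta> 0 = 0" "\<forall>x\<ge>1. \<eta> x = 0 \<or> \<eta> x = 1" and s: "summable (\<lambda>x. real_of_int (\<eta> x))"
    using assms by (auto simp: Omega_fin_def Omega_def)
  have "(\<lambda>x. real_of_int (\<eta> x)) \<longlonglongrightarrow> 0" by (rule summable_LIMSEQ_zero[OF s])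
  then obtain N where "\<forall>x\<ge>N. norm (real_of_int (\<eta> x) - 0) < 1" using LIMSEQ_D zero_less_one by blast
  then have "\<forall>x\<ge>N. \<eta> x = 0" by auto
  moreover have "\<eta> x = 0 \<or> \<eta> x = 1" for x using v by (cases x) auto
  ultimately show ?thesis using v by (auto simp: finconf_def)
qed

theorem theorem2p3:
  fixes \<eta> :: "nat \<Rightarrow> int" and k i :: nat and l :: enat
  assumes "\<eta> \<in> Omega_fin"
    and "k \<ge> 1"
    and "l \<ge> 1"
  shows "slot_decomp (bbs l \<eta>) k (int i) =
         slot_decomp \<eta> k (int i - int (the_enat (min (enat k) l)))"
proof -
  have f: "finconf \<eta>" using assms(1) by (rule finconf_Omega_fin)
  obtain k' where k: "k = Suc k'" using assms(2) by (cases k) auto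
  define a where "a = the_enat (min (enat k) l)"
  have "slot_decomp (bbs l \<eta>) k (int i) = (if i < a then 0 else zeta k' \<eta> (i - a))"
    using zeta_bbs[OF f] by (simp add: k a_def slot_decomp_zeta finconf_bbs f Let_def)
  also have "\<dots> = slot_decomp \<eta> k (int i - int a)"
  proof (cases "i < a")
    case True
    then show ?thesis by (simp add: slot_decomp_def)
  next
    case False
    then have "int i - int a = int (i - a)" by simp
    then show ?thesis using False by (simp add: k slot_decomp_zeta f del: of_nat_diff)
  qed
  finally show ?thesis by (simp add: a_def)
qed

end
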